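(* For all $n\geq 1$ and $0\le k\le n-1$, $$Q_{n,k}(x,t)=\sum_{F\in \mathcal H_{n,k}}x^{\mathrm{tree}(F)-1}\,t^{\mathrm{bdeg}(F)},$$ equivalently, $$Q_n(x,y,1,t)=\sum_{F\in\mathcal H_n}x^{\mathrm{tree}(F)-1}\,y^{\mathrm{imp}(F)}\,t^{\mathrm{bdeg}(F)}.$$
   Context: Define polynomials $Q_n(x,y,z,t)$ by $Q_1=1$ and $Q_{n+1}=[x+nz+(y+t)(n+y\partial_y)]Q_n$ for $n\ge1$, and define $Q_{n,k}(x,t)$ by $Q_n(x,y,1,t)=\sum_{k=0}^{n-1}Q_{n,k}(x,t)y^k$. A half-mobile tree on a set $S$ is a rooted tree with two kinds of vertices, labeled (white) and unlabeled (black), such that the white vertices are in bijection with $S$; each black vertex has at least two children, all of them white; there is a fixed cyclic order on the children of each black vertex; the children of white vertices are unordered. For a vertex $v$, $\beta_T(v)$ is the smallest white descendant of $v$ (the path from the root to a descendant of $v$ passes through $v$; $v$ is its own descendant). The children of a black vertex are listed in the linear order compatible with its cyclic order whose last (rightmost) element is the child with smallest $\beta_T$. An edge $e=(u,v)$ ($v$ a child of $u$) is improper if either $u,v$ are both white and $u>\beta_T(v)$, or $u$ is black, $v$ is its rightmost child, and $u$ has a (white) parent whose label is greater than $\beta_T(v)$. A forest of half-mobile trees on $[n]$ is a graph whose connected components are half-mobile trees and whose set of white vertices is $[n]$; $\mathcal H_n$ is the set of such forests and $\mathcal H_{n,k}$ those with exactly $k$ improper edges. For $F\in\mathcal H_n$: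 $\mathrm{imp}(F)$ = number of improper edges, $\mathrm{tree}(F)$ = number of component trees, $\mathrm{bdeg}(F)=\sum_v(\deg_F(v)-1)$ over black vertices $v$, with $\deg_F(v)$ the number of children of $v$. *)

theory Defs
  imports "HOL-Computational_Algebra.Polynomial" "HOL-Combinatorics.Permutations"
begin

text \<open>Coefficient ring R = Z[x][t][z]: innermost variable x, then t, outermost z.
  Q_n is a polynomial in y (outermost) over R.\<close>

type_synonym R = "int poly poly poly"

definition xR :: R where "xR = [:[:[:0, 1:]:]:]"
definition tR :: R where "tR = [:[:0, 1:]:]"
definition zR :: R where "zR = [:0, 1:]"

definition Qop :: "nat \<Rightarrow> R poly \<Rightarrow> R poly" where
  "Qop n P = smult (xR + of_nat n * zR) P
             + [:tR, 1:] * (smult (of_nat n) P + pCons 0 (pderiv P))"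

fun Q :: "nat \<Rightarrow> R poly" where
  "Q 0 = 0"
| "Q (Suc 0) = 1"
| "Q (Suc (Suc m)) = Qop (Suc m) (Q (Suc m))"

definition Qz1 :: "nat \<Rightarrow> int poly poly poly" where
  "Qz1 n = map_poly (\<lambda>p. poly p 1) (Q n)"

definition Qnk :: "nat \<Rightarrow> nat \<Rightarrow> int poly poly" where
  "Qnk n k = coeff (Qz1 n) k"

text \<open>A white vertex is its label; a black vertex is identified with its set of
  children (which are all white and determine the black vertex uniquely).\<close>
datatype vtx = W nat | Bk "nat set"

text \<open>A forest is given by its parent map (None for roots) and, for every black
  vertex B, a cyclic order on its children encoded as a cyclic permutation of B.\<close>
type_synonym hforest = "(vtx \<Rightarrow> vtx option) \<times> (nat set \<Rightarrow> nat \<Rightarrow> nat)"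

definition blacks :: "(vtx \<Rightarrow> vtx option) \<Rightarrow> nat set set" where
  "blacks par = {B. \<exists>v. par (W v) = Some (Bk B)}"

definition verts :: "nat \<Rightarrow> (vtx \<Rightarrow> vtx option) \<Rightarrow> vtx set" where
  "verts n par = W ` {1..n} \<union> Bk ` blacks par"

definition par_rel :: "(vtx \<Rightarrow> vtx option) \<Rightarrow> (vtx \<times> vtx) set" where
  "par_rel par = {(a, b). par a = Some b}"

definition is_cyclic_order :: "nat set \<Rightarrow> (nat \<Rightarrow> nat) \<Rightarrow> bool" where
  "is_cyclic_order B s \<longleftrightarrow> s permutes B \<and> (\<forall>u\<in>B. \<forall>v\<in>B. \<exists>k. (s ^^ k) u = v)"

definition is_hforest :: "nat \<Rightarrow> hforest \<Rightarrow> bool" where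
  "is_hforest n F \<longleftrightarrow> (let par = fst F; cyc = snd F in
     (\<forall>a. a \<notin> verts n par \<longrightarrow> par a = None)
   \<and> (\<forall>v\<in>{1..n}. case par (W v) of
         None \<Rightarrow> True
       | Some (W u) \<Rightarrow> u \<in> {1..n}
       | Some (Bk B) \<Rightarrow> v \<in> B)
   \<and> (\<forall>B\<in>blacks par. B \<subseteq> {1..n} \<and> 2 \<le> card B
         \<and> (\<forall>v\<in>B. par (W v) = Some (Bk B))
         \<and> (case par (Bk B) of
              None \<Rightarrow> True
            | Some (W u) \<Rightarrow> u \<in> {1..n}
            | Some (Bk _) \<Rightarrow> False))
   \<and> acyclic (par_rel par)
   \<and> (\<forall>B\<in>blacks par. is_cyclic_order B (cyc B))
   \<and> (\<forall>B. B \<notin> blacks par \<longrightarrow> cyc B = id))"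

definition beta :: "(vtx \<Rightarrow> vtx option) \<Rightarrow> vtx \<Rightarrow> nat" where
  "beta par v = Min {u. (W u, v) \<in> (par_rel par)\<^sup>*}"

text \<open>Improperness of the edge from a white vertex W b to its parent
  (every edge ends in a white vertex, since children of black vertices are white
  and black vertices only have white parents or are roots).\<close>
definition improper :: "(vtx \<Rightarrow> vtx option) \<Rightarrow> nat \<Rightarrow> bool" where
  "improper par b \<longleftrightarrow> (case par (W b) of
       None \<Rightarrow> False
     | Some (W a) \<Rightarrow> a > beta par (W b)
     | Some (Bk B) \<Rightarrow> (\<forall>c\<in>B. beta par (W b) \<le> beta par (W c))
                    \<and> (\<exists>a. par (Bk B) = Some (W a) \<and> a > beta par (W b)))"

definition imp :: "nat \<Rightarrow> hforest \<Rightarrow> nat" where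
  "imp n F = card {b \<in> {1..n}. improper (fst F) b}"

definition tree :: "nat \<Rightarrow> hforest \<Rightarrow> nat" where
  "tree n F = card {a \<in> verts n (fst F). fst F a = None}"

definition bdeg :: "hforest \<Rightarrow> nat" where
  "bdeg F = (\<Sum>B\<in>blacks (fst F). card B - 1)"

definition H :: "nat \<Rightarrow> hforest set" where
  "H n = {F. is_hforest n F}"

definition Hk :: "nat \<Rightarrow> nat \<Rightarrow> hforest set" where
  "Hk n k = {F \<in> H n. imp n F = k}"

end

theory Submission
  imports Defs "HOL-Combinatorics.Orbits"
begin

text \<open>
  A half-mobile forest amounts to a rooted forest on the white vertices together with a permutation
  \<open>\<sigma>\<close> of them that preserves the (white) parent: the black vertices are the nontrivial cycles of
  \<open>\<sigma>\<close>, with their cyclic orders. Let the leader of a cycle be the element whose subtree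
  contains the smallest label. Below each parent, write every cycle as a word starting with its
  leader and concatenate these words in decreasing order of the subtree minima of the leaders
  (Foata's transformation). This turns the pair into a plane forest, in which the leaders are the
  vertices whose subtree minimum is smaller than those of all earlier siblings. Leaders carry the
  weight \<open>y\<close>, \<open>1\<close> or \<open>x\<close> (improper, proper, root), all other vertices the weight \<open>t\<close>.

  On plane forests the recurrence for \<open>Q\<close> is the insertion of a new largest label \<open>N\<close>. As a leaf
  it contributes \<open>x + n + n t\<close>. Otherwise it takes the place of a vertex \<open>a\<close>, which becomes a
  child of \<open>N\<close>: either the only child (\<open>n y\<close> in total), or together with a final segment of the
  former children of \<open>a\<close> that begins at an improper leader \<open>c\<close>. In the latter case the children
  of \<open>N\<close> begin with \<open>a, c\<close> or with \<open>c, a\<close>, which gives a factor \<open>y + t\<close> for every improper edge,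
  that is, the operator \<open>(y + t) y \<partial>\<^sub>y\<close>.
\<close>

section \<open>Plane forests and the insertion of a largest label\<close>

text \<open>\<open>Nd a C R\<close> is a list of trees in reverse order: its last tree has root \<open>a\<close> and children \<open>C\<close>, and \<open>R\<close> are
  the trees before it.\<close>

datatype plane_forest = Emp | Nd nat plane_forest plane_forest

primrec labels :: "plane_forest \<Rightarrow> nat set" where
  "labels Emp = {}"
| "labels (Nd a C R) = insert a (labels C \<union> labels R)"

primrec distinct_labels :: "plane_forest \<Rightarrow> bool" where
  "distinct_labels Emp = True"
| "distinct_labels (Nd a C R) \<longleftrightarrow> distinct_labels C \<and> distinct_labels R \<and> a \<notin> labels C \<and> a \<notin> labels R \<and> labels C \<inter> labels R = {}"

text \<open>For disjoint finite sets, compares the minima, with \<open>Min {} = \<infinity>\<close>.\<close>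

definition min_less :: "nat set \<Rightarrow> nat set \<Rightarrow> bool" where
  "min_less A B \<longleftrightarrow> (\<exists>a\<in>A. \<forall>b\<in>B. a < b)"

definition plane_forests :: "nat set \<Rightarrow> plane_forest set" where
  "plane_forests S = {F. distinct_labels F \<and> labels F = S}"

lemma finite_labels [simp]: "finite (labels F)"
  by (induction F) auto

lemma labels_eq_empty [simp]: "labels F = {} \<longleftrightarrow> F = Emp"
  by (cases F) auto

text \<open>Removes a root with the nonempty list \<open>D\<close> of children and lets one of them take its place: the
  first child, or the second one if that is not a leader. The remaining children become the last
  children of the chosen one, and \<open>expand a C\<close> is the set of preimages of \<open>(a, C)\<close>.\<close>

fun contract :: "plane_forest \<Rightarrow> nat \<times> plane_forest" where
  "contract Emp = (0, Emp)"
| "contract (Nd b A Emp) = (b, A)"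
| "contract (Nd b A (Nd c A' R)) =
     (if R = Emp \<and> min_less (insert c (labels A')) (insert b (labels A)) then (b, Nd c A' A)
      else (fst (contract (Nd c A' R)), Nd b A (snd (contract (Nd c A' R)))))"

primrec expand :: "nat \<Rightarrow> plane_forest \<Rightarrow> plane_forest set" where
  "expand a Emp = {Nd a Emp Emp}"
| "expand a (Nd b A C) = insert (Nd a (Nd b A C) Emp)
     (if min_less (insert b (labels A)) (insert a (labels C))
      then insert (Nd a C (Nd b A Emp)) (Nd b A ` expand a C)
      else Nd b A ` (expand a C - {Nd a C Emp}))"

primrec delete :: "nat \<Rightarrow> plane_forest \<Rightarrow> plane_forest" where
  "delete N Emp = Emp"
| "delete N (Nd a C R) =
     (if a = N then (if C = Emp then R else Nd (fst (contract C)) (snd (contract C)) R)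
      else if N \<in> labels C then Nd a (delete N C) R else Nd a C (delete N R))"

text \<open>A new leaf sits at the end of an initial segment of a sibling list: the explicit element
  closes the whole list, and the recursion into \<open>R\<close> reaches the shorter segments down
  to the empty one.\<close>

primrec insertions :: "nat \<Rightarrow> plane_forest \<Rightarrow> plane_forest set" where
  "insertions N Emp = {Nd N Emp Emp}"
| "insertions N (Nd a C R) = insert (Nd N Emp (Nd a C R))
     (Nd a C ` insertions N R \<union> (\<lambda>C'. Nd a C' R) ` insertions N C \<union> (\<lambda>D. Nd N D R) ` expand a C)"

section \<open>Comparison of minima\<close>

lemma min_less_total:
  assumes "finite A" "finite B" "A \<noteq> {}" "A \<inter> B = {}"
  shows "min_less A B \<or> min_less B A"
proof (cases "B = {}")
  case False
  have "Min A \<noteq> Min B" using assms False Min_in by (metis disjoint_iff)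
  then have "Min A < Min B \<or> Min B < Min A" by linarith
  then show ?thesis
  proof
    assume "Min A < Min B"
    then show ?thesis unfolding min_less_def using assms False
      by (metis Min.coboundedI Min_in order_less_le_trans)
  next
    assume "Min B < Min A"
    then show ?thesis unfolding min_less_def using assms False
      by (metis Min.coboundedI Min_in order_less_le_trans)
  qed
qed (use assms in \<open>auto simp: min_less_def\<close>)

lemma min_less_asym: "min_less A B \<Longrightarrow> \<not> min_less B A"
  unfolding min_less_def by (meson order_less_asym)

lemma min_less_insert_right: "min_less A (insert u B) \<longleftrightarrow> (\<exists>a\<in>A. a < u) \<and> min_less A B"
proof
  assume "(\<exists>a\<in>A. a < u) \<and> min_less A B"
  then obtain a a' where "a \<in> A" "a < u" "a' \<in> A" "\<forall>b\<in>B. a' < b" by (auto simp: min_less_def)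
  then show "min_less A (insert u B)"
    unfolding min_less_def by (intro bexI[of _ "min a a'"]) (auto simp: min_def)
qed (auto simp: min_less_def)

lemma min_less_empty [simp]: "min_less A {} \<longleftrightarrow> A \<noteq> {}" "\<not> min_less {} B"
  by (auto simp: min_less_def)

section \<open>Expanding and contracting a vertex\<close>

lemma expand_not_Emp: "D \<in> expand a C \<Longrightarrow> D \<noteq> Emp"
  by (cases C) (auto split: if_splits)

lemma self_in_expand: "Nd a C Emp \<in> expand a C"
  by (cases C) auto

lemma labels_expand: "D \<in> expand a C \<Longrightarrow> labels D = insert a (labels C)"
  by (induction C arbitrary: D) (auto split: if_splits)

lemma distinct_expand:
  "D \<in> expand a C \<Longrightarrow> distinct_labels C \<Longrightarrow> a \<notin> labels C \<Longrightarrow> distinct_labels D"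
  by (induction C arbitrary: D) (auto split: if_splits simp: labels_expand)

text \<open>Appending \<open>b\<close> to the one-element list \<open>Nd a C Emp\<close> keeps
  \<open>a\<close> as the chosen child only if \<open>b\<close> becomes a leader; otherwise
  \<open>contract\<close> would choose \<open>b\<close>. This is why \<open>expand\<close> removes
  that list in its second branch.\<close>

lemma contract_expand: "D \<in> expand a C \<Longrightarrow> distinct_labels C \<Longrightarrow> a \<notin> labels C \<Longrightarrow> contract D = (a, C)"
proof (induction C arbitrary: D)
  case (Nd b A C)
  have *: "contract (Nd b A D') = (a, Nd b A C)"
    if D': "D' \<in> expand a C"
      "min_less (insert b (labels A)) (insert a (labels C)) \<or> D' \<noteq> Nd a C Emp" for D'
  proof -
    have IH: "contract D' = (a, C)" using Nd D' by auto
    obtain c A' R where D'': "D' = Nd c A' R" using expand_not_Emp[OF D'(1)] by (cases D') auto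
    show ?thesis using IH D'' D'(2) min_less_asym by (cases R) auto
  qed
  show ?case using Nd.prems * by (auto split: if_splits)
qed auto

lemma labels_contract: "D \<noteq> Emp \<Longrightarrow> insert (fst (contract D)) (labels (snd (contract D))) = labels D"
  by (induction D rule: contract.induct) (auto split: if_splits)

lemma distinct_contract: "D \<noteq> Emp \<Longrightarrow> distinct_labels D \<Longrightarrow>
    distinct_labels (snd (contract D)) \<and> fst (contract D) \<notin> labels (snd (contract D))"
proof (induction D rule: contract.induct)
  case (3 b A c A' R)
  obtain d D where dD: "contract (Nd c A' R) = (d, D)" by fastforce
  have "insert d (labels D) = labels (Nd c A' R)"
    using labels_contract[of "Nd c A' R"] dD by simp
  then have "d \<in> labels (Nd c A' R)" "labels D \<subseteq> labels (Nd c A' R)" by blast+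
  then show ?case using 3 dD by (auto simp del: contract.simps(2) split: if_splits)
qed auto

lemma expand_contract: "D \<noteq> Emp \<Longrightarrow> distinct_labels D \<Longrightarrow> D \<in> expand (fst (contract D)) (snd (contract D))"
proof (induction D rule: contract.induct)
  case (2 b A)
  then show ?case by (simp add: self_in_expand)
next
  case (3 b A c A' R)
  show ?case
  proof (cases "R = Emp \<and> min_less (insert c (labels A')) (insert b (labels A))")
    case True
    then show ?thesis by auto
  next
    case False
    obtain d D where dD: "contract (Nd c A' R) = (d, D)" by fastforce
    have IH: "Nd c A' R \<in> expand d D" using 3 False dD by auto
    \<comment> \<open>If a single tree precedes \<open>b\<close>, the failed test of
      \<open>contract\<close> and the totality of the comparison make \<open>b\<close> a leader, so
      the first branch of \<open>expand\<close> applies.\<close>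
    have c1: "min_less (insert b (labels A)) (insert d (labels D))" if "Nd c A' R = Nd d D Emp"
    proof -
      have "insert b (labels A) \<inter> insert c (labels A') = {}" using "3.prems"(2) by auto
      then show ?thesis
        using that False min_less_total[of "insert b (labels A)" "insert c (labels A')"] by auto
    qed
    have "Nd b A (Nd c A' R) \<in> expand d (Nd b A D)"
      using c1 IH by (cases "min_less (insert b (labels A)) (insert d (labels D))") auto
    then show ?thesis using False dD by (simp only: contract.simps if_False fst_conv snd_conv)
  qed
qed auto

section \<open>Insertion and deletion of a label\<close>

lemma labels_insertions: "F' \<in> insertions N F \<Longrightarrow> labels F' = insert N (labels F)"
  by (induction F arbitrary: F') (auto simp: labels_expand)

lemma distinct_insertions: "F' \<in> insertions N F \<Longrightarrow> distinct_labels F \<Longrightarrow> N \<notin> labels F \<Longrightarrow> distinct_labels F'"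
  by (induction F arbitrary: F') (auto simp: labels_expand labels_insertions intro: distinct_expand)

lemma delete_insertions: "F' \<in> insertions N F \<Longrightarrow> distinct_labels F \<Longrightarrow> N \<notin> labels F \<Longrightarrow> delete N F' = F"
  by (induction F arbitrary: F') (auto simp: labels_insertions contract_expand dest: expand_not_Emp)

lemma labels_delete: "distinct_labels F \<Longrightarrow> labels (delete N F) = labels F - {N}"
proof (induction F)
  case (Nd a C R)
  then show ?case using labels_contract[of C] by auto
qed auto

lemma distinct_delete: "distinct_labels F \<Longrightarrow> distinct_labels (delete N F)"
proof (induction F)
  case (Nd a C R)
  have "distinct_labels (Nd (fst (contract C)) (snd (contract C)) R)" if "C \<noteq> Emp"
    using labels_contract[OF that] distinct_contract[OF that] Nd.prems by auto
  then show ?case using Nd by (auto simp: labels_delete)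
qed auto

lemma insertions_delete: "distinct_labels F \<Longrightarrow> N \<in> labels F \<Longrightarrow> F \<in> insertions N (delete N F)"
proof (induction F)
  case (Nd a C R)
  show ?case
  proof (cases "a = N")
    case True
    show ?thesis
    proof (cases "C = Emp")
      case True
      then show ?thesis using \<open>a = N\<close> by (cases R) auto
    next
      case False
      then show ?thesis using \<open>a = N\<close> expand_contract[of C] Nd.prems by auto
    qed
  qed (use Nd in auto)
qed auto

lemma finite_expand [simp]: "finite (expand a C)"
  by (induction C) auto

lemma finite_insertions [simp]: "finite (insertions N F)"
  by (induction F) auto

lemma plane_forests_empty: "plane_forests {} = {Emp}"
  by (auto simp: plane_forests_def)

lemma plane_forests_insert: "N \<notin> S \<Longrightarrow> plane_forests (insert N S) = (\<Union>F\<in>plane_forests S. insertions N F)"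
proof (intro equalityI subsetI)
  fix F assume "N \<notin> S" "F \<in> plane_forests (insert N S)"
  then show "F \<in> (\<Union>F\<in>plane_forests S. insertions N F)"
    using insertions_delete[of F N] distinct_delete[of F N] labels_delete[of F N]
    by (auto simp: plane_forests_def intro!: bexI[of _ "delete N F"])
qed (auto simp: plane_forests_def labels_insertions distinct_insertions)

lemma finite_plane_forests: "finite S \<Longrightarrow> finite (plane_forests S)"
  by (induction S rule: finite_induct) (auto simp: plane_forests_empty plane_forests_insert)

text \<open>The sets \<open>insertions N F\<close> are the fibres of \<open>delete N\<close>, hence
  disjoint for different \<open>F\<close>.\<close>

lemma sum_plane_forests_insert:
  assumes "finite S" "N \<notin> S"
  shows "(\<Sum>F\<in>plane_forests (insert N S). f F) = (\<Sum>F\<in>plane_forests S. \<Sum>F'\<in>insertions N F. f F')"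
  unfolding plane_forests_insert[OF assms(2)]
proof (rule sum.UNION_disjoint)
  show "\<forall>F\<in>plane_forests S. \<forall>F'\<in>plane_forests S. F \<noteq> F' \<longrightarrow> insertions N F \<inter> insertions N F' = {}"
  proof (intro ballI impI)
    fix F F' assume "F \<in> plane_forests S" "F' \<in> plane_forests S" "F \<noteq> F'"
    then show "insertions N F \<inter> insertions N F' = {}"
      using delete_insertions[of _ N F] delete_insertions[of _ N F'] assms(2) by (auto simp: plane_forests_def)
  qed
qed (use assms in \<open>auto simp: finite_plane_forests\<close>)

section \<open>Weights and the recurrence\<close>

abbreviation varX :: "int poly poly poly" where "varX \<equiv> [:[:[:0, 1:]:]:]"
abbreviation varT :: "int poly poly poly" where "varT \<equiv> [:[:0, 1:]:]"
abbreviation varY :: "int poly poly poly" where "varY \<equiv> [:0, 1:]"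

text \<open>\<open>u\<close> is the parent (\<open>0\<close> for roots), \<open>D\<close> the label set of the subtree and \<open>E\<close> that of the earlier siblings.\<close>

definition edge_wt :: "nat \<Rightarrow> nat set \<Rightarrow> nat set \<Rightarrow> int poly poly poly" where
  "edge_wt u D E = (if min_less D E then if \<exists>d\<in>D. d < u then varY else if u = 0 then varX else 1 else varT)"

primrec wt :: "nat \<Rightarrow> plane_forest \<Rightarrow> int poly poly poly" where
  "wt u Emp = 1"
| "wt u (Nd a C R) = edge_wt u (insert a (labels C)) (labels R) * wt a C * wt u R"

text \<open>By \<open>min_less_insert_right\<close>, the single comparison with
  \<open>insert u (labels R)\<close> tests for a leader and for an improper edge at once.\<close>

primrec imp_top :: "nat \<Rightarrow> plane_forest \<Rightarrow> nat" where
  "imp_top u Emp = 0"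
| "imp_top u (Nd a C R) = (if min_less (insert a (labels C)) (insert u (labels R)) then 1 else 0) + imp_top u R"

text \<open>Improper leaders at the top level are not counted here.\<close>

primrec imp_below :: "plane_forest \<Rightarrow> nat" where
  "imp_below Emp = 0"
| "imp_below (Nd a C R) = imp_top a C + imp_below C + imp_below R"

lemma imp_top_0 [simp]: "imp_top 0 F = 0"
  by (induction F) (auto simp: min_less_insert_right)

text \<open>\<open>wt u F\<close> is a monomial whose exponent of \<open>varY\<close> is the number
  of improper leaders; the Euler operator multiplies it by this exponent.\<close>

lemma varY_pderiv_wt: "varY * pderiv (wt u F) = of_nat (imp_top u F + imp_below F) * wt u F"
proof (induction F arbitrary: u)
  case (Nd a C R)
  let ?e = "edge_wt u (insert a (labels C)) (labels R)"
  have e: "varY * pderiv ?e = (if min_less (insert a (labels C)) (insert u (labels R)) then 1 else 0) * ?e"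
    by (auto simp: edge_wt_def min_less_insert_right pderiv_pCons)
  have "varY * pderiv (wt u (Nd a C R)) =
      (varY * pderiv ?e) * wt a C * wt u R + ?e * (varY * pderiv (wt a C)) * wt u R
        + ?e * wt a C * (varY * pderiv (wt u R))"
    by (simp only: wt.simps pderiv_mult) algebra
  also have "\<dots> = of_nat (imp_top u (Nd a C R) + imp_below (Nd a C R)) * wt u (Nd a C R)"
    unfolding Nd e by (simp add: algebra_simps del: mult_pCons_left mult_pCons_right)
  finally show ?case .
qed (simp add: pderiv_1)

lemma imp_top_eq_0: "\<not> (\<exists>c\<in>labels C. c < a) \<Longrightarrow> imp_top a C = 0"
  by (induction C) (auto simp: min_less_def)

lemma edge_wt_last:
  assumes "\<forall>d\<in>D. d < N" "D \<noteq> {}"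
  shows "edge_wt N D {} = varY"
  using assms by (auto simp: edge_wt_def min_less_def)

text \<open>As \<open>N\<close> exceeds all labels, an edge from \<open>N\<close> weighs
  \<open>varY\<close> for a leader and \<open>varT\<close> otherwise. The expansion with
  \<open>a\<close> as only child gives \<open>varY\<close>; each improper leader \<open>c\<close>
  below \<open>a\<close> gives two more, with factor \<open>varY\<close> if \<open>a\<close>
  precedes \<open>c\<close> and \<open>varT\<close> if \<open>c\<close> precedes
  \<open>a\<close>.\<close>

lemma sum_expand:
  assumes "distinct_labels C" "a \<notin> labels C" "a < N" "\<forall>v\<in>labels C. v < N" "a > 0" "0 \<notin> labels C"
  shows "(\<Sum>D\<in>expand a C. wt N D) = wt a C * (varY + (varY + varT) * of_nat (imp_top a C))"
  using assms
proof (induction C)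
  case Emp
  then show ?case by (simp add: edge_wt_last)
next
  case (Nd b A C)
  let ?B = "insert b (labels A)" and ?C = "insert a (labels C)"
  have IH: "(\<Sum>D\<in>expand a C. wt N D) = wt a C * (varY + (varY + varT) * of_nat (imp_top a C))"
    using Nd by auto
  have last: "wt N (Nd a C Emp) = varY * wt a C"
    if "\<forall>v\<in>labels C. v < N" for C
    using that Nd by (simp add: edge_wt_last)
  have first: "wt N (Nd a (Nd b A C) Emp) = varY * wt a (Nd b A C)"
    using Nd.prems by (intro last) auto
  have fr: "Nd a (Nd b A C) Emp \<notin> Nd b A ` S" for S using Nd.prems by auto
  have inj: "inj_on (Nd b A) S" for S by (auto simp: inj_on_def)
  have e: "edge_wt N ?B (labels D) = (if min_less ?B ?C then varY else varT)" if "D \<in> expand a C" for D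
    using Nd.prems labels_expand[OF that] by (auto simp: edge_wt_def min_less_insert_right min_less_def)
  have sumB: "(\<Sum>D\<in>Nd b A ` S. wt N D) = (if min_less ?B ?C then varY else varT) * wt b A * (\<Sum>D\<in>S. wt N D)"
    if "S \<subseteq> expand a C" for S
  proof -
    have "(\<Sum>D\<in>Nd b A ` S. wt N D) = (\<Sum>D\<in>S. wt N (Nd b A D))"
      by (simp add: sum.reindex[OF inj])
    also have "\<dots> = (\<Sum>D\<in>S. (if min_less ?B ?C then varY else varT) * wt b A * wt N D)"
      using that by (intro sum.cong refl) (auto simp: e)
    finally show ?thesis by (simp only: sum_distrib_left)
  qed
  show ?case
  proof (cases "min_less ?B ?C")
    case True
    then have wtC: "wt a (Nd b A C) = varY * wt b A * wt a C"
      by (simp add: edge_wt_def min_less_insert_right del: mult_pCons_left)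
    have it: "imp_top a (Nd b A C) = Suc (imp_top a C)" using True by simp
    \<comment> \<open>Here \<open>b\<close> comes first and is an improper leader below
      \<open>N\<close>, while \<open>a\<close> follows a tree with a smaller minimum and gets
      \<open>varT\<close>.\<close>
    have extra: "wt N (Nd a C (Nd b A Emp)) = varT * wt a (Nd b A C)"
    proof -
      have "edge_wt N ?C ?B = varT" using min_less_asym[OF True] by (simp add: edge_wt_def)
      moreover have "edge_wt N ?B {} = varY" using Nd.prems by (intro edge_wt_last) auto
      ultimately show ?thesis unfolding wtC by (simp del: mult_pCons_left)
    qed
    have n1: "Nd a C (Nd b A Emp) \<notin> Nd b A ` expand a C" using Nd.prems by auto
    have n2: "Nd a (Nd b A C) Emp \<notin> insert (Nd a C (Nd b A Emp)) (Nd b A ` expand a C)"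
      using fr by auto
    have "(\<Sum>D\<in>expand a (Nd b A C). wt N D)
      = wt N (Nd a (Nd b A C) Emp) + (wt N (Nd a C (Nd b A Emp)) + (\<Sum>D\<in>Nd b A ` expand a C. wt N D))"
      using True unfolding expand.simps
      by (simp only: if_True sum.insert[OF _ n1] sum.insert[OF _ n2] finite_insert finite_imageI
          finite_expand)
    also have "\<dots> = varY * wt a (Nd b A C) + (varT * wt a (Nd b A C)
        + varY * wt b A * (wt a C * (varY + (varY + varT) * of_nat (imp_top a C))))"
      using sumB[of "expand a C"] True IH first extra by simp
    also have "\<dots> = wt a (Nd b A C) * (varY + (varY + varT) * of_nat (imp_top a (Nd b A C)))"
      unfolding wtC it by (simp only: of_nat_Suc) algebra
    finally show ?thesis .
  next
    case False
    have it: "imp_top a (Nd b A C) = imp_top a C" using False by simp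
    let ?S = "expand a C - {Nd a C Emp}"
    have sumS: "(\<Sum>D\<in>?S. wt N D) = wt a C * (varY + varT) * of_nat (imp_top a C)"
    proof -
      have "(\<Sum>D\<in>?S. wt N D) = (\<Sum>D\<in>expand a C. wt N D) - wt N (Nd a C Emp)"
        using self_in_expand by (simp del: wt.simps add: sum_diff1)
      also have "wt N (Nd a C Emp) = varY * wt a C" using Nd.prems by (intro last) auto
      finally show ?thesis unfolding IH by algebra
    qed
    \<comment> \<open>Either \<open>b\<close> is no leader and its edge below \<open>a\<close>
      weighs \<open>varT\<close>, or it is a proper leader. In the second case all earlier siblings
      have only labels above \<open>a\<close>, and both sides vanish with
      \<open>imp_top a C\<close>.\<close>
    have key: "varT * wt b A * wt a C * of_nat (imp_top a C) = wt a (Nd b A C) * of_nat (imp_top a C)"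
    proof (cases "min_less ?B (labels C)")
      case True
      then have "\<not> (\<exists>b\<in>?B. b < a)" using False min_less_insert_right by blast
      have "\<not> (\<exists>c\<in>labels C. c < a)"
      proof
        assume "(\<exists>c\<in>labels C. c < a)"
        then obtain c where c: "c \<in> labels C" "c < a" by (auto simp: min_less_def)
        moreover obtain d where "d \<in> ?B" "\<forall>c\<in>labels C. d < c" using True by (auto simp: min_less_def)
        ultimately have "d \<in> ?B" "d < a" by auto
        then show False using \<open>\<not> (\<exists>b\<in>?B. b < a)\<close> by (auto simp: min_less_def)
      qed
      then show ?thesis using imp_top_eq_0 by simp
    next
      case False
      then show ?thesis by (simp add: edge_wt_def del: mult_pCons_left)
    qed
    have "(\<Sum>D\<in>expand a (Nd b A C). wt N D)
      = wt N (Nd a (Nd b A C) Emp) + (\<Sum>D\<in>Nd b A ` ?S. wt N D)"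
      using False unfolding expand.simps
      by (simp only: if_False sum.insert[OF _ fr] finite_imageI finite_Diff finite_expand)
    also have "\<dots> = varY * wt a (Nd b A C) + varT * wt b A * (wt a C * (varY + varT) * of_nat (imp_top a C))"
      using sumB[of ?S] False first sumS by simp
    also have "\<dots> = varY * wt a (Nd b A C) + (varY + varT) * (varT * wt b A * wt a C * of_nat (imp_top a C))"
      by algebra
    also have "\<dots> = wt a (Nd b A C) * (varY + (varY + varT) * of_nat (imp_top a (Nd b A C)))"
      unfolding key it by algebra
    finally show ?thesis .
  qed
qed

text \<open>Inserting a largest label among the earlier siblings does not change whether a later
  sibling is a leader.\<close>

lemma min_less_labels_insertions:
  assumes "F' \<in> insertions N F" "D \<noteq> {}" "\<forall>d\<in>D. d < N"
  shows "min_less D (labels F') = min_less D (labels F)"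
  using assms by (auto simp: min_less_def labels_insertions)

text \<open>For the new leaf, each sibling list has a first position, of weight \<open>1\<close> or
  \<open>varX\<close>, and each vertex has the position after it, of weight \<open>varT\<close>.
  Every vertex owns one list of children, so with the \<open>varY\<close> from
  \<open>sum_expand\<close> it contributes \<open>varT + 1 + varY\<close>.\<close>

lemma sum_insertions:
  assumes "distinct_labels F" "\<forall>v\<in>labels F. 0 < v \<and> v < N" "u < N"
  shows "(\<Sum>F'\<in>insertions N F. wt u F') = wt u F * ((if u = 0 then varX else 1)
    + of_nat (card (labels F)) * (varT + 1 + varY) + (varY + varT) * of_nat (imp_below F))"
  using assms
proof (induction F arbitrary: u)
  case Emp
  then show ?case by (auto simp: edge_wt_def min_less_def)
next
  case (Nd a C R)
  let ?C = "insert a (labels C)" and ?r = "if u = 0 then varX else 1"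
  let ?e = "edge_wt u ?C (labels R)"
  have N: "\<forall>v\<in>?C. v < N" "\<forall>v\<in>labels R. v < N" "a > 0" using Nd.prems by auto
  have IHC: "(\<Sum>F'\<in>insertions N C. wt a F') = wt a C * (1 + of_nat (card (labels C)) * (varT + 1 + varY)
      + (varY + varT) * of_nat (imp_below C))"
    using Nd.IH(1)[of a] Nd.prems by auto
  have IHR: "(\<Sum>F'\<in>insertions N R. wt u F') = wt u R * (?r + of_nat (card (labels R)) * (varT + 1 + varY)
      + (varY + varT) * of_nat (imp_below R))"
    using Nd.IH(2)[of u] Nd.prems by auto
  have J: "(\<Sum>D\<in>expand a C. wt N D) = wt a C * (varY + (varY + varT) * of_nat (imp_top a C))"
    using Nd.prems by (intro sum_expand) auto
  have crd: "card (labels (Nd a C R)) = Suc (card (labels C) + card (labels R))"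
    using Nd.prems by (simp add: card_Un_disjoint)
  have NC: "Nd N Emp (Nd a C R) \<notin> Nd a C ` S" for S using N by auto
  have leaf: "wt u (Nd N Emp (Nd a C R)) = varT * wt u (Nd a C R)"
  proof -
    have "\<not> min_less {N} (labels (Nd a C R))" using N by (auto simp: min_less_def)
    then show ?thesis by (simp add: edge_wt_def del: mult_pCons_left)
  qed
  have sR: "(\<Sum>F'\<in>Nd a C ` insertions N R. wt u F') = ?e * wt a C * (\<Sum>F'\<in>insertions N R. wt u F')"
  proof -
    have "edge_wt u ?C (labels F') = ?e" if "F' \<in> insertions N R" for F'
    proof -
      have "min_less ?C (labels F') = min_less ?C (labels R)"
        using min_less_labels_insertions[OF that, of ?C] N by auto
      then show ?thesis by (simp add: edge_wt_def)
    qed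
    then have "(\<Sum>F'\<in>Nd a C ` insertions N R. wt u F') = (\<Sum>F'\<in>insertions N R. ?e * wt a C * wt u F')"
      by (subst sum.reindex) (auto simp: inj_on_def intro!: sum.cong simp del: mult_pCons_left)
    then show ?thesis by (simp only: sum_distrib_left)
  qed
  have sC: "(\<Sum>F'\<in>(\<lambda>C'. Nd a C' R) ` insertions N C. wt u F') = ?e * wt u R * (\<Sum>F'\<in>insertions N C. wt a F')"
  proof -
    have "edge_wt u (insert a (labels F')) (labels R) = ?e" if "F' \<in> insertions N C" for F'
    proof -
      have "min_less (insert a (labels F')) E = min_less ?C E" for E
        using labels_insertions[OF that] N order_less_trans by (fastforce simp: min_less_def)
      moreover have "(\<exists>d\<in>insert a (labels F'). d < u) = (\<exists>d\<in>?C. d < u)"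
        using labels_insertions[OF that] \<open>u < N\<close> by auto
      ultimately show ?thesis by (simp add: edge_wt_def)
    qed
    then have "(\<Sum>F'\<in>(\<lambda>C'. Nd a C' R) ` insertions N C. wt u F') = (\<Sum>F'\<in>insertions N C. ?e * wt u R * wt a F')"
      by (subst sum.reindex) (auto simp: inj_on_def mult_ac intro!: sum.cong simp del: mult_pCons_left)
    then show ?thesis by (simp only: sum_distrib_left)
  qed
  have sJ: "(\<Sum>F'\<in>(\<lambda>D. Nd N D R) ` expand a C. wt u F') = ?e * wt u R * (\<Sum>D\<in>expand a C. wt N D)"
  proof -
    \<comment> \<open>\<open>N\<close> takes over the subtree of \<open>a\<close>, enlarged only by
      the largest label, so the edge to the parent keeps its weight.\<close>
    have "edge_wt u (insert N (labels D)) (labels R) = ?e" if "D \<in> expand a C" for D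
    proof -
      have "min_less (insert N (labels D)) E = min_less ?C E" for E
        using labels_expand[OF that] N order_less_trans by (fastforce simp: min_less_def)
      moreover have "(\<exists>d\<in>insert N (labels D). d < u) = (\<exists>d\<in>?C. d < u)"
        using labels_expand[OF that] \<open>u < N\<close> by auto
      ultimately show ?thesis by (simp add: edge_wt_def)
    qed
    then have "(\<Sum>F'\<in>(\<lambda>D. Nd N D R) ` expand a C. wt u F') = (\<Sum>D\<in>expand a C. ?e * wt u R * wt N D)"
      by (subst sum.reindex) (auto simp: inj_on_def mult_ac intro!: sum.cong simp del: mult_pCons_left)
    then show ?thesis by (simp only: sum_distrib_left)
  qed
  have d1: "Nd a C ` insertions N R \<inter> (\<lambda>C'. Nd a C' R) ` insertions N C = {}"
    using labels_insertions[of C N C] N by auto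
  have d2: "(Nd a C ` insertions N R \<union> (\<lambda>C'. Nd a C' R) ` insertions N C) \<inter> (\<lambda>D. Nd N D R) ` expand a C = {}"
    using N by auto
  have d3: "Nd N Emp (Nd a C R) \<notin> Nd a C ` insertions N R \<union> (\<lambda>C'. Nd a C' R) ` insertions N C
      \<union> (\<lambda>D. Nd N D R) ` expand a C"
    using N expand_not_Emp[of Emp a C] by auto
  have "(\<Sum>F'\<in>insertions N (Nd a C R). wt u F') = varT * wt u (Nd a C R)
    + (?e * wt a C * (\<Sum>F'\<in>insertions N R. wt u F') + ?e * wt u R * (\<Sum>F'\<in>insertions N C. wt a F')
       + ?e * wt u R * (\<Sum>D\<in>expand a C. wt N D))"
    unfolding insertions.simps
    by (simp only: sum.insert[OF _ d3] sum.union_disjoint[OF _ _ d2] sum.union_disjoint[OF _ _ d1]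
        finite_Un finite_imageI finite_insertions finite_expand leaf sR sC sJ)
  also have "\<dots> = wt u (Nd a C R) * (?r + of_nat (card (labels (Nd a C R))) * (varT + 1 + varY)
      + (varY + varT) * of_nat (imp_below (Nd a C R)))"
    unfolding IHC IHR J crd wt.simps imp_below.simps of_nat_add of_nat_Suc by algebra
  finally show ?case .
qed

section \<open>The recurrence of the generating polynomial\<close>

definition forest_poly :: "nat \<Rightarrow> int poly poly poly" where
  "forest_poly n = (\<Sum>F\<in>plane_forests {1..n}. wt 0 F)"

lemma pderiv_sum: "pderiv (\<Sum>i\<in>A. f i) = (\<Sum>i\<in>A. pderiv (f i))"
  by (induction A rule: infinite_finite_induct) (auto simp: pderiv_add)

lemma forest_poly_Suc: "forest_poly (Suc n) = (varX + of_nat n * (varT + 1 + varY)) * forest_poly n + (varY + varT) * (varY * pderiv (forest_poly n))"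
proof -
  have "forest_poly (Suc n) = (\<Sum>F\<in>plane_forests (insert (Suc n) {1..n}). wt 0 F)"
    by (simp add: forest_poly_def atLeastAtMostSuc_conv)
  also have "\<dots> = (\<Sum>F\<in>plane_forests {1..n}. \<Sum>F'\<in>insertions (Suc n) F. wt 0 F')"
    by (rule sum_plane_forests_insert) auto
  also have "\<dots> = (\<Sum>F\<in>plane_forests {1..n}. (varX + of_nat n * (varT + 1 + varY)) * wt 0 F
      + (varY + varT) * (varY * pderiv (wt 0 F)))"
  proof (rule sum.cong[OF refl])
    fix F assume F: "F \<in> plane_forests {1..n}"
    have "(\<Sum>F'\<in>insertions (Suc n) F. wt 0 F') = wt 0 F * (varX + of_nat n * (varT + 1 + varY)
        + (varY + varT) * of_nat (imp_below F))"
      using F by (subst sum_insertions) (auto simp: plane_forests_def)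
    then show "(\<Sum>F'\<in>insertions (Suc n) F. wt 0 F') = (varX + of_nat n * (varT + 1 + varY)) * wt 0 F
      + (varY + varT) * (varY * pderiv (wt 0 F))"
      \<comment> \<open>No label is below the parent \<open>0\<close> of the roots, so
        \<open>imp_below F\<close> is the whole exponent of \<open>varY\<close>.\<close>
      unfolding varY_pderiv_wt imp_top_0 by (simp only: of_nat_add of_nat_0 add_0 distrib_left distrib_right mult_ac add_ac)
  qed
  also have "\<dots> = (varX + of_nat n * (varT + 1 + varY)) * forest_poly n + (varY + varT) * (varY * pderiv (forest_poly n))"
    by (simp only: forest_poly_def sum.distrib sum_distrib_left pderiv_sum)
  finally show ?thesis .
qed

lemma coeff_Qz1: "coeff (Qz1 n) k = poly (coeff (Q n) k) 1"
  by (simp add: Qz1_def coeff_map_poly)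

lemma coeff_varY_pderiv: "coeff (pCons 0 (pderiv p)) k = of_nat k * coeff p k"
  by (cases k) (simp_all add: coeff_pderiv)

lemma coeff_linear_times:
  "coeff ([:a :: 'a :: comm_ring_1, 1:] * p) k = a * coeff p k + (if k = 0 then 0 else coeff p (k - 1))"
  by (cases k) simp_all

text \<open>\<open>z\<close> is set to \<open>1\<close> inside the coefficients with respect to
  \<open>y\<close>, so the two sides are compared coefficient by coefficient.\<close>

lemma Qz1_Suc:
  assumes "n \<ge> 1"
  shows "Qz1 (Suc n) = (varX + of_nat n * (varT + 1 + varY)) * Qz1 n + (varY + varT) * (varY * pderiv (Qz1 n))"
proof -
  obtain m where m: "n = Suc m" using assms by (cases n) auto
  have Q: "Q (Suc n) = Qop n (Q n)" using m by simp
  define D where "D = smult (of_nat n) (Qz1 n) + pCons 0 (pderiv (Qz1 n))"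
  have "coeff (Qz1 (Suc n)) k
      = coeff (smult ([:[:0, 1:]:] + of_nat n) (Qz1 n) + [:[:0, 1:], 1:] * D) k" for k
    unfolding coeff_Qz1 Q Qop_def xR_def tR_def zR_def D_def coeff_add coeff_linear_times coeff_smult
      coeff_varY_pderiv
    by (simp add: of_nat_poly flip: smult_add_left)
  then have "Qz1 (Suc n) = smult ([:[:0, 1:]:] + of_nat n) (Qz1 n) + [:[:0, 1:], 1:] * D"
    by (metis poly_eqI)
  also have "\<dots> = (varX + of_nat n) * Qz1 n + (varY + varT) * D"
    by (simp add: of_nat_poly smult_add_left)
  also have "D = of_nat n * Qz1 n + varY * pderiv (Qz1 n)"
    by (simp add: D_def of_nat_poly)
  finally show ?thesis by (simp only: algebra_simps mult_1_right)
qed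

text \<open>Forests carry a factor \<open>varX\<close> for every tree, \<open>Q\<close> for every
  tree but one; multiplying by \<open>varX\<close> avoids a division.\<close>

lemma varX_times_Qz1:
  assumes "n \<ge> 1"
  shows "varX * Qz1 n = forest_poly n"
  using assms
proof (induction n rule: dec_induct)
  case base
  have "forest_poly 1 = varX"
    \<comment> \<open>The recurrence for forests already holds from \<open>0\<close> on, where the
      empty forest has weight \<open>1\<close>.\<close>
    using forest_poly_Suc[of 0] by (simp add: forest_poly_def plane_forests_empty)
  moreover have "Qz1 1 = 1"
    by (rule poly_eqI) (simp add: coeff_Qz1)
  ultimately show ?case by simp
next
  case (step n)
  have pd: "pderiv (forest_poly n) = varX * pderiv (Qz1 n)"
    unfolding step.IH[symmetric] pderiv_mult by (simp add: pderiv_pCons)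
  show ?case
    unfolding forest_poly_Suc pd Qz1_Suc[OF step.hyps(1)] unfolding step.IH[symmetric]
    by (simp only: distrib_left distrib_right mult_ac add_ac)
qed

section \<open>Rooted forests with a permutation of siblings\<close>

definition edges :: "(nat \<Rightarrow> nat) \<Rightarrow> nat set \<Rightarrow> (nat \<times> nat) set" where
  "edges p S = {(v, p v) | v. v \<in> S}"

definition descendants :: "(nat \<Rightarrow> nat) \<Rightarrow> nat set \<Rightarrow> nat \<Rightarrow> nat set" where
  "descendants p S v = {w. (w, v) \<in> (edges p S)\<^sup>*}"

text \<open>\<open>u\<close> stands for the root of the whole structure; the value \<open>0\<close> of \<open>p\<close> outside \<open>S\<close> is a convention.\<close>

definition perm_forests :: "nat \<Rightarrow> nat set \<Rightarrow> ((nat \<Rightarrow> nat) \<times> (nat \<Rightarrow> nat)) set" where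
  "perm_forests u S = {(p, \<sigma>). \<sigma> permutes S \<and> (\<forall>v. v \<notin> S \<longrightarrow> p v = 0)
     \<and> (\<forall>v\<in>S. p v \<in> insert u S \<and> (v, u) \<in> (edges p S)\<^sup>+ \<and> p (\<sigma> v) = p v)}"

primrec parent_of :: "nat \<Rightarrow> plane_forest \<Rightarrow> nat \<Rightarrow> nat" where
  "parent_of u Emp = (\<lambda>v. 0)"
| "parent_of u (Nd a C R) = (\<lambda>v. if v = a then u else if v \<in> labels C then parent_of a C v else parent_of u R v)"

text \<open>Leaders are the left-to-right minima of the list, so the last one is the root whose tree
  contains the smallest label, see \<open>subtree_lead\<close>.\<close>

primrec lead :: "plane_forest \<Rightarrow> nat" where
  "lead Emp = 0"
| "lead (Nd a C R) = (if min_less (insert a (labels C)) (labels R) then a else lead R)"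

text \<open>A last sibling that is not a leader is inserted into the cycle of the smallest subtree, just before its leader.\<close>

primrec sibling_perm :: "plane_forest \<Rightarrow> nat \<Rightarrow> nat" where
  "sibling_perm Emp = id"
| "sibling_perm (Nd a C R) = sibling_perm C \<circ> (if min_less (insert a (labels C)) (labels R) then id else transpose a (lead R)) \<circ> sibling_perm R"

primrec subtree :: "plane_forest \<Rightarrow> nat \<Rightarrow> nat set" where
  "subtree Emp v = {}"
| "subtree (Nd a C R) v = (if v = a then insert a (labels C) else if v \<in> labels C then subtree C v else subtree R v)"

text \<open>Siblings appended later never change the leader of an existing cycle, so it is fixed
  when a vertex is added: the vertex itself or the current \<open>lead\<close>.\<close>

primrec leader_of :: "plane_forest \<Rightarrow> nat \<Rightarrow> nat" where
  "leader_of Emp v = v"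
| "leader_of (Nd a C R) v = (if v = a then lead (Nd a C R) else if v \<in> labels C then leader_of C v else leader_of R v)"

section \<open>Edges and descendants of a parent map\<close>

lemma edges_cong: "(\<And>v. v \<in> S \<Longrightarrow> p v = q v) \<Longrightarrow> edges p S = edges q S"
  by (auto simp: edges_def)

lemma edges_mono: "S \<subseteq> S' \<Longrightarrow> edges p S \<subseteq> edges p S'"
  by (auto simp: edges_def)

lemma in_edges [simp]: "(v, w) \<in> edges p S \<longleftrightarrow> v \<in> S \<and> w = p v"
  by (auto simp: edges_def)

lemma single_valued_edges: "single_valued (edges p S)"
  by (auto simp: single_valued_def)

text \<open>Paths from the same \<open>w\<close> in a functional graph are comparable, so one of
  \<open>v\<close>, \<open>v'\<close> leads to the other. But the only step from a child of
  \<open>u\<close> ends in \<open>u\<close>, which has no outgoing edge.\<close>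

lemma descendants_top_unique:
  assumes "u \<notin> S" "v \<in> S" "v' \<in> S" "p v = u" "p v' = u" "w \<in> descendants p S v" "w \<in> descendants p S v'"
  shows "v = v'"
proof (rule ccontr)
  assume "v \<noteq> v'"
  have *: False if "x \<in> S" "y \<in> S" "p x = u" "(x, y) \<in> (edges p S)\<^sup>*" "x \<noteq> y" for x y
  proof -
    obtain z where "(x, z) \<in> edges p S" and zy: "(z, y) \<in> (edges p S)\<^sup>*"
      using \<open>x \<noteq> y\<close> \<open>(x, y) \<in> _\<close> by (meson converse_rtranclE)
    then have "z = u" using that by auto
    with zy have "(u, y) \<in> (edges p S)\<^sup>*" by simp
    then show False using \<open>y \<in> S\<close> \<open>u \<notin> S\<close> by (cases rule: converse_rtranclE) auto
  qed
  have "(v, v') \<in> (edges p S)\<^sup>* \<or> (v', v) \<in> (edges p S)\<^sup>*"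
    using single_valued_confluent[OF single_valued_edges] assms unfolding descendants_def by auto
  then show False using *[of v v'] *[of v' v] assms \<open>v \<noteq> v'\<close> by auto
qed

section \<open>Parent map and permutation of a plane forest\<close>

lemma parent_of_outside: "v \<notin> labels F \<Longrightarrow> parent_of u F v = 0"
  by (induction F arbitrary: u) auto

lemma parent_of_range: "v \<in> labels F \<Longrightarrow> parent_of u F v \<in> insert u (labels F)"
  by (induction F arbitrary: u) auto

lemma lead_in: "F \<noteq> Emp \<Longrightarrow> lead F \<in> labels F"
proof (induction F)
  case (Nd a C R)
  then show ?case by (cases "R = Emp") auto
qed auto

lemma parent_of_lead: "F \<noteq> Emp \<Longrightarrow> distinct_labels F \<Longrightarrow> parent_of u F (lead F) = u"
proof (induction F)
  case (Nd a C R)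
  then show ?case using lead_in[of R] by (cases "R = Emp") auto
qed auto

lemma subtree_lead: "F \<noteq> Emp \<Longrightarrow> distinct_labels F \<Longrightarrow> Min (labels F) \<in> subtree F (lead F)"
proof (induction F)
  case (Nd a C R)
  let ?D = "insert a (labels C)"
  show ?case
  proof (cases "min_less ?D (labels R)")
    case True
    then obtain d where d: "d \<in> ?D" "\<forall>r\<in>labels R. d < r" by (auto simp: min_less_def)
    have "Min (labels (Nd a C R)) \<notin> labels R"
    proof
      assume "Min (labels (Nd a C R)) \<in> labels R"
      then have "d < Min (labels (Nd a C R))" using d by auto
      moreover have "Min (labels (Nd a C R)) \<le> d" using d by (intro Min_le) auto
      ultimately show False using leD by blast
    qed
    moreover have "Min (labels (Nd a C R)) \<in> labels (Nd a C R)" by (intro Min_in) auto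
    ultimately show ?thesis using True by auto
  next
    case False
    then have R: "R \<noteq> Emp" by auto
    have "min_less (labels R) ?D"
      using False min_less_total[of ?D "labels R"] Nd.prems by auto
    then obtain d where d: "d \<in> labels R" "\<forall>r\<in>?D. d < r" by (auto simp: min_less_def)
    have "Min (labels (Nd a C R)) = Min (labels R)"
    proof (rule Min_eqI)
      show "Min (labels R) \<in> labels (Nd a C R)" using R Min_in[of "labels R"] by auto
      fix y assume "y \<in> labels (Nd a C R)"
      then consider "y \<in> ?D" | "y \<in> labels R" by auto
      then show "Min (labels R) \<le> y"
      proof cases
        case 1
        then have "d < y" using d by blast
        then show ?thesis using Min_le[OF finite_labels d(1)] by linarith
      qed auto
    qed simp
    then show ?thesis using Nd R False lead_in[OF R] by auto
  qed
qed auto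

lemma sibling_perm_permutes: "distinct_labels F \<Longrightarrow> sibling_perm F permutes labels F"
proof (induction F)
  case (Nd a C R)
  let ?S = "labels (Nd a C R)"
  have "sibling_perm C permutes ?S" "sibling_perm R permutes ?S"
    using Nd by (auto intro: permutes_subset)
  moreover have "(if min_less (insert a (labels C)) (labels R) then id else transpose a (lead R)) permutes ?S"
    using lead_in[of R] by (cases "R = Emp") (auto intro: permutes_swap_id permutes_id)
  ultimately show ?case by (simp only: sibling_perm.simps) (blast intro: permutes_compose)
qed (simp add: permutes_id)

lemma sibling_perm_in: "distinct_labels F \<Longrightarrow> sibling_perm F v \<in> labels F \<longleftrightarrow> v \<in> labels F"
  by (rule permutes_in_image[OF sibling_perm_permutes])

lemma sibling_perm_outside: "distinct_labels F \<Longrightarrow> v \<notin> labels F \<Longrightarrow> sibling_perm F v = v"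
  by (rule permutes_not_in[OF sibling_perm_permutes])

text \<open>This makes the last root recoverable: it is the preimage of the lead under the
  permutation.\<close>

lemma sibling_perm_Nd_top: "distinct_labels (Nd a C R) \<Longrightarrow> sibling_perm (Nd a C R) a = lead (Nd a C R)"
proof (cases "R = Emp")
  case False
  assume d: "distinct_labels (Nd a C R)"
  have "lead R \<notin> labels C" using d lead_in[OF False] by auto
  then show ?thesis using d by (auto simp: sibling_perm_outside)
qed (auto simp: sibling_perm_outside)

lemma sibling_perm_Nd_children:
  assumes "distinct_labels (Nd a C R)" "v \<in> labels C"
  shows "sibling_perm (Nd a C R) v = sibling_perm C v"
proof (cases "R = Emp")
  case False
  have "v \<noteq> a" "v \<notin> labels R" "v \<noteq> lead R" using assms lead_in[OF False] by auto
  then show ?thesis using assms by (auto simp: sibling_perm_outside transpose_def)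
qed (use assms in auto)

text \<open>Splicing \<open>a\<close> into a cycle just before \<open>lead R\<close> changes only
  the image of the predecessor of \<open>lead R\<close>.\<close>

lemma sibling_perm_Nd_rest:
  assumes "distinct_labels (Nd a C R)" "v \<in> labels R"
  shows "sibling_perm (Nd a C R) v =
    (if \<not> min_less (insert a (labels C)) (labels R) \<and> sibling_perm R v = lead R then a else sibling_perm R v)"
proof -
  have "R \<noteq> Emp" using assms by auto
  then have "sibling_perm R v \<in> labels R" "lead R \<in> labels R" using assms lead_in by (simp_all add: sibling_perm_in)
  then have "sibling_perm R v \<notin> labels C" "lead R \<notin> labels C" "sibling_perm R v \<noteq> a" "a \<notin> labels C" using assms by auto
  then show ?thesis using assms by (auto simp: sibling_perm_outside transpose_def)
qed

lemma sibling_perm_lead_top: "distinct_labels (Nd a C R) \<Longrightarrow> parent_of u (Nd a C R) (sibling_perm (Nd a C R) a) = u"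
  by (simp only: sibling_perm_Nd_top parent_of_lead plane_forest.distinct not_False_eq_True)

text \<open>Splicing joins \<open>a\<close> to the cycle of \<open>lead R\<close>, and both have the
  parent \<open>u\<close>.\<close>

lemma parent_of_sibling_perm: "distinct_labels F \<Longrightarrow> v \<in> labels F \<Longrightarrow> parent_of u F (sibling_perm F v) = parent_of u F v"
proof (induction F arbitrary: u)
  case (Nd a C R)
  consider "v = a" | "v \<in> labels C" | "v \<in> labels R" using Nd.prems by auto
  then show ?case
  proof cases
    case 1
    then show ?thesis using sibling_perm_lead_top[OF Nd.prems(1)] by simp
  next
    case 2
    then show ?thesis using Nd sibling_perm_in[of C v] by (simp only: sibling_perm_Nd_children) auto
  next
    case 3
    then have R: "R \<noteq> Emp" by auto
    have "sibling_perm R v \<in> labels R" "sibling_perm R v \<notin> labels C" "sibling_perm R v \<noteq> a" "v \<notin> labels C" "v \<noteq> a"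
      using 3 Nd.prems sibling_perm_in[of R v] by auto
    then show ?thesis using 3 Nd parent_of_lead[OF R, of u] by (simp only: sibling_perm_Nd_rest) auto
  qed
qed auto

section \<open>Subtrees as sets of descendants\<close>

lemma subtree_subset: "subtree F v \<subseteq> labels F"
  by (induction F) auto

lemma self_in_subtree: "v \<in> labels F \<Longrightarrow> v \<in> subtree F v"
  by (induction F) auto

lemma edges_parent_of:
  assumes "distinct_labels (Nd a C R)"
  shows "edges (parent_of u (Nd a C R)) (labels (Nd a C R))
    = insert (a, u) (edges (parent_of a C) (labels C) \<union> edges (parent_of u R) (labels R))"
  using assms by (auto simp: edges_def)

lemma reach_parent_of: "distinct_labels F \<Longrightarrow> v \<in> labels F \<Longrightarrow> (v, u) \<in> (edges (parent_of u F) (labels F))\<^sup>+"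
proof (induction F arbitrary: u)
  case (Nd a C R)
  let ?E = "edges (parent_of u (Nd a C R)) (labels (Nd a C R))"
  have C: "edges (parent_of a C) (labels C) \<subseteq> ?E" and R: "edges (parent_of u R) (labels R) \<subseteq> ?E" and a: "(a, u) \<in> ?E"
    using edges_parent_of[OF Nd.prems(1)] by auto
  consider "v = a" | "v \<in> labels C" | "v \<in> labels R" using Nd.prems by auto
  then show ?case
  proof cases
    case 2
    then have "(v, a) \<in> ?E\<^sup>+" using Nd trancl_mono[OF _ C] by auto
    then show ?thesis using a by (rule trancl_into_trancl)
  next
    case 3
    then show ?thesis using Nd trancl_mono[OF _ R] by auto
  qed (use a in auto)
qed auto

lemma subtree_step:
  assumes "distinct_labels F" "u \<notin> labels F" "v \<in> labels F" "x \<in> labels F" "parent_of u F x \<in> subtree F v"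
  shows "x \<in> subtree F v"
  using assms
proof (induction F arbitrary: u)
  case (Nd a C R)
  have ranges: "x \<in> labels C \<Longrightarrow> parent_of a C x \<in> insert a (labels C)" "x \<in> labels R \<Longrightarrow> parent_of u R x \<in> insert u (labels R)"
    by (rule parent_of_range; assumption)+
  note subs = subtree_subset[of C v] subtree_subset[of R v]
  consider "v = a" | "v \<in> labels C" "v \<noteq> a" | "v \<in> labels R" "v \<noteq> a" "v \<notin> labels C" using Nd.prems by auto
  then show ?case
  proof cases
    case 1
    then show ?thesis using Nd.prems ranges by (auto split: if_splits)
  next
    case 2
    then show ?thesis using Nd.prems ranges subs Nd.IH(1)[of a] by (auto split: if_splits)
  next
    case 3
    then show ?thesis using Nd.prems ranges subs Nd.IH(2)[of u] by (auto split: if_splits)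
  qed
qed auto

lemma subtree_reach: "distinct_labels F \<Longrightarrow> w \<in> subtree F v \<Longrightarrow> (w, v) \<in> (edges (parent_of u F) (labels F))\<^sup>*"
proof (induction F arbitrary: u)
  case (Nd a C R)
  let ?E = "edges (parent_of u (Nd a C R)) (labels (Nd a C R))"
  have C: "edges (parent_of a C) (labels C) \<subseteq> ?E" and R: "edges (parent_of u R) (labels R) \<subseteq> ?E"
    using edges_parent_of[OF Nd.prems(1)] by auto
  consider "v = a" "w = a" | "v = a" "w \<in> labels C" | "w \<in> subtree C v" | "w \<in> subtree R v"
    using Nd.prems by (auto split: if_splits)
  then show ?case
  proof cases
    case 2
    then have "(w, a) \<in> (edges (parent_of a C) (labels C))\<^sup>+" using reach_parent_of[of C w a] Nd.prems by simp
    then show ?thesis using 2 trancl_mono[OF _ C] trancl_into_rtrancl by metis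
  next
    case 3
    then have "(w, v) \<in> (edges (parent_of a C) (labels C))\<^sup>*" using Nd by simp
    then show ?thesis using rtrancl_mono[OF C] by blast
  next
    case 4
    then have "(w, v) \<in> (edges (parent_of u R) (labels R))\<^sup>*" using Nd by simp
    then show ?thesis using rtrancl_mono[OF R] by blast
  qed auto
qed auto

lemma descendants_parent_of:
  assumes "distinct_labels F" "u \<notin> labels F" "v \<in> labels F"
  shows "descendants (parent_of u F) (labels F) v = subtree F v"
proof (intro equalityI subsetI)
  fix w assume "w \<in> descendants (parent_of u F) (labels F) v"
  then have "(w, v) \<in> (edges (parent_of u F) (labels F))\<^sup>*" by (simp add: descendants_def)
  then show "w \<in> subtree F v"
    by (induction rule: converse_rtrancl_induct)
       (use assms subtree_step self_in_subtree in auto)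
qed (use assms subtree_reach in \<open>auto simp: descendants_def\<close>)

lemma perm_forests_parent_of_sibling_perm: "distinct_labels F \<Longrightarrow> u \<notin> labels F \<Longrightarrow> (parent_of u F, sibling_perm F) \<in> perm_forests u (labels F)"
  unfolding perm_forests_def using sibling_perm_permutes parent_of_outside parent_of_range reach_parent_of parent_of_sibling_perm by auto

section \<open>Decoding a plane forest\<close>

lemma lead_unique:
  assumes "distinct_labels F" "u \<notin> labels F" "v \<in> labels F" "parent_of u F v = u" "Min (labels F) \<in> subtree F v"
  shows "v = lead F"
proof -
  have F: "F \<noteq> Emp" using assms by auto
  show ?thesis
    using assms lead_in[OF F] parent_of_lead[OF F] subtree_lead[OF F] descendants_parent_of
    by (intro descendants_top_unique[of u "labels F" v "lead F" "parent_of u F" "Min (labels F)"]) auto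
qed

text \<open>The parent map determines the subtrees and thus the lead; its preimage under the
  permutation is the last root \<open>a\<close>. The subtree of \<open>a\<close> separates
  \<open>C\<close> from \<open>R\<close>, and cutting \<open>a\<close> out of its cycle leaves the
  permutation of \<open>R\<close>.\<close>

lemma inj_parent_of_sibling_perm:
  assumes "distinct_labels F" "distinct_labels F'" "labels F = labels F'" "u \<notin> labels F"
    "parent_of u F = parent_of u F'" "sibling_perm F = sibling_perm F'"
  shows "F = F'"
  using assms
proof (induction F arbitrary: u F')
  case Emp
  then show ?case using labels_eq_empty[of F'] by simp
next
  case (Nd a C R)
  then have "F' \<noteq> Emp" by auto
  then obtain a' C' R' where F': "F' = Nd a' C' R'" by (cases F') auto
  let ?F = "Nd a C R" and ?F' = "Nd a' C' R'"
  have d: "distinct_labels ?F" "distinct_labels ?F'" "labels ?F' = labels ?F" "u \<notin> labels ?F" "u \<notin> labels ?F'"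
    using Nd.prems unfolding F' by auto
  have parent_of: "parent_of u ?F' = parent_of u ?F" and sibling_perm: "sibling_perm ?F' = sibling_perm ?F"
    using Nd.prems unfolding F' by (simp_all only:)
  have subtree: "subtree ?F' v = subtree ?F v" if "v \<in> labels ?F" for v
    using descendants_parent_of[OF d(1,4) that] descendants_parent_of[OF d(2,5), of v] that d(3) parent_of by (simp only:)
  have lead: "lead ?F' = lead ?F"
    using lead_unique[OF d(1,4), of "lead ?F'"] lead_in[of ?F'] parent_of_lead[of ?F' u] subtree_lead[of ?F'] d parent_of subtree
    by (metis plane_forest.distinct(1))
  have "sibling_perm ?F a' = sibling_perm ?F a"
    using sibling_perm_Nd_top[OF d(1)] sibling_perm_Nd_top[OF d(2)] lead sibling_perm by (simp only:)
  then have a: "a' = a"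
    using sibling_perm_permutes[OF d(1)] by (meson injD permutes_inj)
  have lC: "labels C' = labels C" using subtree[of a] d a by auto
  have lR: "labels R' = labels R" using d a lC by auto
  have nC: "v \<noteq> a" if "v \<in> labels C" for v using that d by auto
  have nR: "v \<noteq> a" "v \<notin> labels C" if "v \<in> labels R" for v using that d by auto
  have ppC: "parent_of a C' = parent_of a C"
  proof
    fix v show "parent_of a C' v = parent_of a C v"
      using fun_cong[OF parent_of, of v] nC[of v] a lC by (cases "v \<in> labels C") (auto simp: parent_of_outside)
  qed
  have ppR: "parent_of u R' = parent_of u R"
  proof
    fix v show "parent_of u R' v = parent_of u R v"
      using fun_cong[OF parent_of, of v] nR[of v] a lC lR by (cases "v \<in> labels R") (auto simp: parent_of_outside)
  qed
  have sgC: "sibling_perm C' = sibling_perm C"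
  proof
    fix v show "sibling_perm C' v = sibling_perm C v"
      using fun_cong[OF sibling_perm, of v] sibling_perm_Nd_children[OF d(1), of v] sibling_perm_Nd_children[OF d(2), of v] d a lC
      by (cases "v \<in> labels C") (auto simp del: sibling_perm.simps simp: sibling_perm_outside)
  qed
  have sgR: "sibling_perm R' = sibling_perm R"
  proof
    fix v show "sibling_perm R' v = sibling_perm R v"
    proof (cases "v \<in> labels R")
      case True
      have "sibling_perm R v \<in> labels R" "sibling_perm R' v \<in> labels R'"
        using True d lR sibling_perm_in[of R v] sibling_perm_in[of R' v] by simp_all
      then have ne: "sibling_perm R v \<noteq> a" "sibling_perm R' v \<noteq> a" using d lR by auto
      show ?thesis
      proof (cases "min_less (insert a (labels C)) (labels R)")
        case True
        then show ?thesis
          using fun_cong[OF sibling_perm, of v] sibling_perm_Nd_rest[OF d(1), of v] sibling_perm_Nd_rest[OF d(2), of v] d a lC lR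
            \<open>v \<in> labels R\<close> by (simp del: sibling_perm.simps)
      next
        case False
        then have "lead R' = lead R" using lead a lC lR by simp
        then show ?thesis
          using False fun_cong[OF sibling_perm, of v] sibling_perm_Nd_rest[OF d(1), of v] sibling_perm_Nd_rest[OF d(2), of v] d a lC lR
            \<open>v \<in> labels R\<close> ne by (simp del: sibling_perm.simps split: if_splits)
      qed
    qed (use d lR in \<open>simp add: sibling_perm_outside\<close>)
  qed
  have "C = C'"
    by (rule Nd.IH(1)[OF _ _ _ _ ppC[symmetric] sgC[symmetric]]) (use d lC in auto)
  moreover have "R = R'"
    by (rule Nd.IH(2)[OF _ _ _ _ ppR[symmetric] sgR[symmetric]]) (use d lR in auto)
  ultimately show ?case using a F' by simp
qed

lemma permutes_finiteI:
  assumes "finite A" "inj_on f A" "f ` A \<subseteq> A" "\<And>x. x \<notin> A \<Longrightarrow> f x = x"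
  shows "f permutes A"
  using assms by (intro bij_imp_permutes) (auto simp: bij_betw_def endo_inj_surj)

text \<open>By \<open>sibling_perm_Nd_top\<close> the last root has to be the preimage
  \<open>a\<close> of the child \<open>l\<close> of \<open>u\<close> above the smallest label. The
  induction hypothesis applies to the proper descendants of \<open>a\<close> and to the vertices
  outside its subtree.\<close>

lemma surj_parent_of_sibling_perm:
  assumes "finite S" "u \<notin> S" "(p, \<sigma>) \<in> perm_forests u S"
  shows "\<exists>F. distinct_labels F \<and> labels F = S \<and> parent_of u F = p \<and> sibling_perm F = \<sigma>"
  using assms
proof (induction S arbitrary: u p \<sigma> rule: finite_psubset_induct)
  case (psubset S)
  have perm: "\<sigma> permutes S" and p0: "\<And>v. v \<notin> S \<Longrightarrow> p v = 0"
    and pS: "\<And>v. v \<in> S \<Longrightarrow> p v \<in> insert u S" and reach: "\<And>v. v \<in> S \<Longrightarrow> (v, u) \<in> (edges p S)\<^sup>+"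
    and p\<sigma>: "\<And>v. v \<in> S \<Longrightarrow> p (\<sigma> v) = p v"
    using psubset.prems by (auto simp: perm_forests_def)
  have \<sigma>S: "\<sigma> v \<in> S \<longleftrightarrow> v \<in> S" for v using perm by (rule permutes_in_image)
  have \<sigma>inj: "\<sigma> v = \<sigma> w \<Longrightarrow> v = w" for v w using permutes_inj[OF perm] by (rule injD)
  show ?case
  proof (cases "S = {}")
    case True
    then show ?thesis using p0 perm by (intro exI[of _ Emp]) auto
  next
    case False
    let ?E = "edges p S"
    define m where "m = Min S"
    have m: "m \<in> S" "\<And>v. v \<in> S \<Longrightarrow> m \<le> v"
      using False \<open>finite S\<close> by (auto simp: m_def)
    \<comment> \<open>\<open>l\<close> is the last vertex before \<open>u\<close> on the path from
      \<open>m\<close> to \<open>u\<close>.\<close>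
    obtain l where l: "l \<in> S" "p l = u" "m \<in> descendants p S l"
      using reach[OF m(1)] by (cases rule: tranclE) (auto simp: descendants_def dest: trancl_into_rtrancl)
    define a where "a = inv \<sigma> l"
    have \<sigma>a: "\<sigma> a = l" unfolding a_def using perm by (simp add: permutes_inverses)
    have aS: "a \<in> S" using \<sigma>a \<sigma>S l by metis
    have pa: "p a = u" using p\<sigma>[OF aS] \<sigma>a l by simp
    define D where "D = descendants p S a"
    define SC where "SC = D - {a}"
    define SR where "SR = S - D"
    have aD: "a \<in> D" by (simp add: D_def descendants_def)
    have DS: "v \<in> S" if "v \<in> D" for v
      using that aS unfolding D_def descendants_def by (auto elim: converse_rtranclE)
    have Dstep: "v \<in> D" if "v \<in> S" "p v \<in> D" for v
      using that unfolding D_def descendants_def by (auto intro: converse_rtrancl_into_rtrancl)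
    have SCp: "p v \<in> D" if "v \<in> SC" for v
      using that unfolding D_def SC_def descendants_def by (auto elim: converse_rtranclE)
    have uD: "u \<notin> D" using DS psubset.prems by auto
    have SC\<sigma>: "\<sigma> v \<in> SC" if "v \<in> SC" for v
    proof -
      have "v \<in> S" using that DS by (auto simp: SC_def)
      then have "\<sigma> v \<in> D" using Dstep[of "\<sigma> v"] SCp[OF that] p\<sigma> \<sigma>S by auto
      moreover have "\<sigma> v \<noteq> a" using SCp[OF that] p\<sigma>[OF \<open>v \<in> S\<close>] pa uD by auto
      ultimately show ?thesis by (simp add: SC_def)
    qed
    have SRp: "p v \<in> insert u SR" if "v \<in> SR" for v
      using that pS[of v] Dstep[of v] by (auto simp: SR_def)
    have SR\<sigma>: "\<sigma> v \<in> SR" if "v \<in> SR" "\<sigma> v \<noteq> a" for v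
    proof (rule ccontr)
      assume "\<sigma> v \<notin> SR"
      then have "\<sigma> v \<in> SC" using that \<sigma>S by (auto simp: SR_def SC_def)
      then have "p v \<in> D" using SCp[of "\<sigma> v"] p\<sigma>[of v] that by (auto simp: SR_def)
      then show False using Dstep that by (auto simp: SR_def)
    qed
    have lSR: "l \<in> SR" if "a \<noteq> l"
    proof (rule ccontr)
      assume "l \<notin> SR"
      then have "l \<in> SC" using that l by (auto simp: SR_def SC_def)
      then show False using SCp l uD by auto
    qed
    \<comment> \<open>If \<open>a = l\<close>, then \<open>a\<close> is a fixed point and no other
      vertex is sent to it.\<close>
    have al: "a \<noteq> l" if "v \<in> SR" "\<sigma> v = a" for v
      using that \<sigma>inj[of v a] \<sigma>a aD by (auto simp: SR_def)
    have split: "S = insert a (SC \<union> SR)" "a \<notin> SC" "a \<notin> SR" "SC \<inter> SR = {}" "u \<notin> SR"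
      using DS aD psubset.prems by (auto simp: SC_def SR_def)
    have fin: "finite SC" "finite SR" using split \<open>finite S\<close> by auto
    define pC where "pC v = (if v \<in> SC then p v else 0)" for v
    define pR where "pR v = (if v \<in> SR then p v else 0)" for v
    define \<sigma>C where "\<sigma>C v = (if v \<in> SC then \<sigma> v else v)" for v
    \<comment> \<open>\<open>a\<close> is cut out of its cycle: its predecessor is redirected to its
      successor \<open>l\<close>.\<close>
    define \<sigma>R where "\<sigma>R v = (if v \<in> SR then if \<sigma> v = a then l else \<sigma> v else v)" for v
    have EC: "edges pC SC = edges p SC" and ER: "edges pR SR = edges p SR"
      by (auto intro!: edges_cong simp: pC_def pR_def)
    have "\<exists>C. distinct_labels C \<and> labels C = SC \<and> parent_of a C = pC \<and> sibling_perm C = \<sigma>C"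
    proof (rule psubset.IH)
      show "SC \<subset> S" using split(1,2) by blast
      show "a \<notin> SC" by (rule split(2))
      have "\<sigma>C permutes SC"
        using fin SC\<sigma> \<sigma>inj by (intro permutes_finiteI) (auto simp: \<sigma>C_def inj_on_def)
      moreover have "(v, a) \<in> (edges p SC)\<^sup>+" if "v \<in> SC" for v
      proof -
        have "(v, a) \<in> ?E\<^sup>*" using that by (simp add: SC_def D_def descendants_def)
        then have "v = a \<or> (v, a) \<in> (edges p SC)\<^sup>+"
        proof (induction rule: converse_rtrancl_induct)
          case (step y z)
          then have "y \<in> D" by (auto simp: D_def descendants_def intro: converse_rtrancl_into_rtrancl)
          then have "y = a \<or> (y, z) \<in> edges p SC" using step by (auto simp: SC_def)
          then show ?case using step by (auto intro: trancl_into_trancl2)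
        qed simp
        then show ?thesis using that split by auto
      qed
      moreover have "p v = a \<or> p v \<in> SC" if "v \<in> SC" for v
        using SCp[OF that] by (auto simp: SC_def)
      ultimately show "(pC, \<sigma>C) \<in> perm_forests a SC"
        using SC\<sigma> p\<sigma> split by (auto simp: perm_forests_def EC pC_def \<sigma>C_def)
    qed
    then obtain C where C: "distinct_labels C" "labels C = SC" "parent_of a C = pC" "sibling_perm C = \<sigma>C" by blast
    have "\<exists>R. distinct_labels R \<and> labels R = SR \<and> parent_of u R = pR \<and> sibling_perm R = \<sigma>R"
    proof (rule psubset.IH)
      show "SR \<subset> S" using split(1,3) by blast
      show "u \<notin> SR" by (rule split(5))
      have "\<sigma>R permutes SR"
      proof (rule permutes_finiteI)
        show "inj_on \<sigma>R SR"
        proof (rule inj_onI)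
          fix v w assume vw: "v \<in> SR" "w \<in> SR" "\<sigma>R v = \<sigma>R w"
          have "\<sigma> v \<noteq> l" "\<sigma> w \<noteq> l"
            using \<sigma>inj[of v a] \<sigma>inj[of w a] vw \<sigma>a split(3) by auto
          then show "v = w"
            using vw \<sigma>inj[of v w] by (auto simp: \<sigma>R_def split: if_splits)
        qed
        show "\<sigma>R ` SR \<subseteq> SR" using lSR al SR\<sigma> by (auto simp: \<sigma>R_def)
      qed (use fin in \<open>auto simp: \<sigma>R_def\<close>)
      moreover have "(v, u) \<in> (edges p SR)\<^sup>+" if "v \<in> SR" for v
      proof -
        have "(v, u) \<in> ?E\<^sup>+" using that reach by (simp add: SR_def)
        then show ?thesis using that
        proof (induction rule: converse_trancl_induct)
          case (step y z)
          have "z \<in> S" using step(2) by (auto elim: converse_tranclE)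
          then have "z \<in> SR" using step SRp[of y] psubset.prems by auto
          then show ?case using step by (auto intro: trancl_into_trancl2)
        qed auto
      qed
      moreover have "p (\<sigma>R v) = p v" if "v \<in> SR" for v
        using that p\<sigma>[of v] pa l split by (auto simp: \<sigma>R_def)
      moreover have "\<sigma>R v \<in> SR" if "v \<in> SR" for v
        using that lSR al SR\<sigma> by (auto simp: \<sigma>R_def)
      ultimately show "(pR, \<sigma>R) \<in> perm_forests u SR"
        using SRp by (auto simp: perm_forests_def ER pR_def)
    qed
    then obtain R where R: "distinct_labels R" "labels R = SR" "parent_of u R = pR" "sibling_perm R = \<sigma>R" by blast
    let ?F = "Nd a C R"
    have dF: "distinct_labels ?F" and lF: "labels ?F = S" using C R split by auto
    have "parent_of u ?F = p"
      using C R split p0 pa by (auto simp: fun_eq_iff pC_def pR_def)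
    \<comment> \<open>The smallest label lies in the tree of \<open>a\<close> exactly if
      \<open>a = l\<close>, so \<open>sibling_perm\<close> splices \<open>a\<close> in precisely
      when \<open>\<sigma>\<close> moves it.\<close>
    moreover have min_less: "min_less (insert a (labels C)) (labels R) \<longleftrightarrow> a = l"
    proof
      assume "a = l"
      then have "m \<in> insert a (labels C)" using l C by (auto simp: D_def SC_def)
      moreover have "m < b" if "b \<in> labels R" for b
        using m(2)[of b] that calculation C R split by (cases "m = b") auto
      ultimately show "min_less (insert a (labels C)) (labels R)" by (auto simp: min_less_def)
    next
      assume L: "min_less (insert a (labels C)) (labels R)"
      show "a = l"
      proof (rule ccontr)
        assume "a \<noteq> l"
        then have "m \<notin> D"
          using descendants_top_unique[of u S a l p m] aS l pa psubset.prems by (auto simp: D_def)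
        then have "m \<in> labels R" using R m by (simp add: SR_def)
        then obtain d where "d \<in> insert a (labels C)" "d < m" using L by (auto simp: min_less_def)
        then show False using m(2)[of d] C split by auto
      qed
    qed
    \<comment> \<open>The smallest label now lies in \<open>SR\<close>, and both \<open>l\<close>
      and \<open>lead R\<close> are children of \<open>u\<close> above it.\<close>
    have ldR: "lead R = l" if "a \<noteq> l"
    proof -
      have R0: "R \<noteq> Emp" using lSR[OF that] R by auto
      have "m \<in> SR"
        using descendants_top_unique[of u S a l p m] aS l pa psubset.prems that m by (auto simp: D_def SR_def)
      then have "Min SR = m" using m fin split by (intro Min_eqI) auto
      then have "m \<in> descendants pR SR (lead R)"
        using subtree_lead[OF R0 R(1)] descendants_parent_of[of R u "lead R"] lead_in[OF R0] R split by auto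
      then have "m \<in> descendants p S (lead R)"
        using ER rtrancl_mono[OF edges_mono[of SR S p]] split unfolding descendants_def by auto
      moreover have "lead R \<in> SR" using lead_in[OF R0] R by simp
      moreover have "p (lead R) = u" using parent_of_lead[OF R0 R(1), of u] R \<open>lead R \<in> SR\<close> by (simp add: pR_def)
      ultimately show ?thesis
        using descendants_top_unique[of u S "lead R" l p m] l split psubset.prems by auto
    qed
    have "sibling_perm ?F = \<sigma>"
    proof
      fix v
      consider "v = a" | "v \<in> SC" | "v \<in> SR" | "v \<notin> S" using split(1) by auto
      then show "sibling_perm ?F v = \<sigma> v"
      proof cases
        case 1
        then show ?thesis using sibling_perm_Nd_top[OF dF] min_less ldR \<sigma>a by auto
      next
        case 2
        then show ?thesis using sibling_perm_Nd_children[OF dF] C by (simp add: \<sigma>C_def)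
      next
        case 3
        have "sibling_perm ?F v = (if a \<noteq> l \<and> \<sigma>R v = l then a else \<sigma>R v)"
          unfolding sibling_perm_Nd_rest[OF dF 3[folded R(2)]] min_less R(4) using ldR by auto
        moreover have "\<sigma> v \<noteq> l" using \<sigma>inj[of v a] 3 \<sigma>a split(3) by auto
        ultimately show ?thesis using 3 al[OF 3] by (auto simp: \<sigma>R_def)
      next
        case 4
        then show ?thesis using sibling_perm_outside[OF dF, of v] lF perm by (simp only: permutes_not_in not_False_eq_True)
      qed
    qed
    ultimately show ?thesis using dF lF by blast
  qed
qed

lemma bij_betw_plane_forests_perm_forests:
  assumes "finite S" "u \<notin> S"
  shows "bij_betw (\<lambda>F. (parent_of u F, sibling_perm F)) (plane_forests S) (perm_forests u S)"
  unfolding bij_betw_def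
proof
  show "inj_on (\<lambda>F. (parent_of u F, sibling_perm F)) (plane_forests S)"
    using inj_parent_of_sibling_perm assms by (auto simp: inj_on_def plane_forests_def)
  show "(\<lambda>F. (parent_of u F, sibling_perm F)) ` plane_forests S = perm_forests u S"
    using perm_forests_parent_of_sibling_perm surj_parent_of_sibling_perm[OF assms] assms by (fastforce simp: plane_forests_def image_iff)
qed

section \<open>Leaders of cycles\<close>

lemma leader_of_in: "v \<in> labels F \<Longrightarrow> leader_of F v \<in> labels F"
proof (induction F)
  case (Nd a C R)
  then show ?case using lead_in[of "Nd a C R"] by auto
qed auto

lemma leader_of_lead: "F \<noteq> Emp \<Longrightarrow> distinct_labels F \<Longrightarrow> leader_of F (lead F) = lead F"
proof (induction F)
  case (Nd a C R)
  show ?case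
  proof (cases "min_less (insert a (labels C)) (labels R)")
    case False
    then have R: "R \<noteq> Emp" by auto
    have "lead R \<noteq> a" "lead R \<notin> labels C" using lead_in[OF R] Nd.prems by auto
    then show ?thesis using Nd R False by auto
  qed auto
qed auto

lemma leader_of_sibling_perm: "distinct_labels F \<Longrightarrow> v \<in> labels F \<Longrightarrow> leader_of F (sibling_perm F v) = leader_of F v"
proof (induction F)
  case (Nd a C R)
  consider "v = a" | "v \<in> labels C" | "v \<in> labels R" using Nd.prems by auto
  then show ?case
  proof cases
    case 1
    then show ?thesis using sibling_perm_Nd_top[OF Nd.prems(1)] leader_of_lead[OF _ Nd.prems(1)] by simp
  next
    case 2
    then have "sibling_perm C v \<in> labels C" "sibling_perm C v \<noteq> a" "v \<noteq> a" using Nd.prems sibling_perm_in[of C v] by auto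
    then show ?thesis using Nd 2 by (simp only: sibling_perm_Nd_children) simp
  next
    case 3
    then have R: "R \<noteq> Emp" by auto
    have "sibling_perm R v \<in> labels R" using 3 Nd.prems sibling_perm_in[of R v] by simp
    then have "sibling_perm R v \<notin> labels C" "sibling_perm R v \<noteq> a" "v \<notin> labels C" "v \<noteq> a" using 3 Nd.prems by auto
    then show ?thesis using 3 Nd leader_of_lead[OF R] by (simp only: sibling_perm_Nd_rest) auto
  qed
qed auto

text \<open>A vertex that is not its own leader failed to beat its earlier siblings, and its leader
  is the one of them whose tree has the smallest minimum.\<close>

lemma min_less_subtree_leader_of: "distinct_labels F \<Longrightarrow> v \<in> labels F \<Longrightarrow> leader_of F v \<noteq> v \<Longrightarrow> min_less (subtree F (leader_of F v)) (subtree F v)"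
proof (induction F)
  case (Nd a C R)
  let ?D = "insert a (labels C)"
  consider "v = a" | "v \<in> labels C" "v \<noteq> a" | "v \<in> labels R" "v \<noteq> a" "v \<notin> labels C"
    using Nd.prems by auto
  then show ?case
  proof cases
    case 1
    then have "\<not> min_less ?D (labels R)" using Nd.prems by auto
    moreover from this have R: "R \<noteq> Emp" by auto
    ultimately have L: "min_less (labels R) ?D" "leader_of (Nd a C R) v = lead R"
      using min_less_total[of ?D "labels R"] Nd.prems 1 by auto
    from L(1) obtain d where d: "d \<in> labels R" "\<forall>x\<in>?D. d < x" by (auto simp: min_less_def)
    have "Min (labels R) \<in> subtree R (lead R)" using subtree_lead[OF R] Nd.prems by simp
    moreover have "\<forall>x\<in>?D. Min (labels R) < x"
      using d Min_le[OF finite_labels d(1)] by (meson order_le_less_trans)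
    ultimately have "min_less (subtree R (lead R)) ?D" by (auto simp: min_less_def)
    moreover have "subtree (Nd a C R) (lead R) = subtree R (lead R)" using lead_in[OF R] Nd.prems by auto
    ultimately show ?thesis using 1 L(2) by simp
  next
    case 2
    then show ?thesis using Nd leader_of_in[of v C] by auto
  next
    case 3
    then have "leader_of R v \<in> labels R" by (simp add: leader_of_in)
    then have "leader_of R v \<noteq> a" "leader_of R v \<notin> labels C" using Nd.prems by auto
    then show ?thesis using Nd 3 by auto
  qed
qed auto

text \<open>When \<open>a\<close> is added, the permutation sends it to the lead in one step; later
  splicings only lengthen cycles.\<close>

lemma leader_of_in_orbit: "distinct_labels F \<Longrightarrow> v \<in> labels F \<Longrightarrow> leader_of F v \<in> orbit (sibling_perm F) v"
proof (induction F)
  case (Nd a C R)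
  let ?F = "Nd a C R"
  consider "v = a" | "v \<in> labels C" "v \<noteq> a" | "v \<in> labels R" "v \<noteq> a" "v \<notin> labels C"
    using Nd.prems by auto
  then show ?case
  proof cases
    case 1
    have "lead ?F \<in> orbit (sibling_perm ?F) a" using orbit.base[of "sibling_perm ?F" a] sibling_perm_Nd_top[OF Nd.prems(1)] by (simp only:)
    moreover have "leader_of ?F v = lead ?F" using 1 by simp
    ultimately show ?thesis using 1 by (simp only:)
  next
    case 2
    have "y \<in> orbit (sibling_perm ?F) v \<and> y \<in> labels C" if "y \<in> orbit (sibling_perm C) v" for y
      using that
    proof induction
      case base
      then show ?case using orbit.base[of "sibling_perm ?F" v] sibling_perm_Nd_children[OF Nd.prems(1) 2(1)] 2 Nd.prems sibling_perm_in[of C v]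
        by (simp del: sibling_perm.simps)
    next
      case (step y)
      then show ?case using orbit.step[of y "sibling_perm ?F" v] sibling_perm_Nd_children[OF Nd.prems(1), of y] Nd.prems sibling_perm_in[of C y]
        by (simp del: sibling_perm.simps)
    qed
    then show ?thesis using 2 Nd by (simp del: sibling_perm.simps)
  next
    case 3
    then have R: "R \<noteq> Emp" by auto
    \<comment> \<open>One step of \<open>sibling_perm R\<close> is one step of
      \<open>sibling_perm ?F\<close>, or two steps through \<open>a\<close> if \<open>a\<close> was
      spliced in before the target.\<close>
    have step: "sibling_perm R y \<in> orbit (sibling_perm ?F) v \<and> sibling_perm R y \<in> labels R"
      if "y \<in> labels R" "sibling_perm ?F y \<in> orbit (sibling_perm ?F) v" for y
    proof (cases "\<not> min_less (insert a (labels C)) (labels R) \<and> sibling_perm R y = lead R")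
      case True
      then have "a \<in> orbit (sibling_perm ?F) v" using that sibling_perm_Nd_rest[OF Nd.prems(1), of y] by (simp del: sibling_perm.simps)
      then have "sibling_perm ?F a \<in> orbit (sibling_perm ?F) v" by (rule orbit.step)
      moreover have "sibling_perm ?F a = sibling_perm R y" using True sibling_perm_Nd_top[OF Nd.prems(1)] by simp
      ultimately show ?thesis using True lead_in[OF R] by (simp del: sibling_perm.simps)
    next
      case False
      then show ?thesis using that sibling_perm_Nd_rest[OF Nd.prems(1), of y] Nd.prems sibling_perm_in[of R y]
        by (simp del: sibling_perm.simps split: if_splits)
    qed
    have "y \<in> orbit (sibling_perm ?F) v \<and> y \<in> labels R" if "y \<in> orbit (sibling_perm R) v" for y
      using that
    proof induction
      case base
      show ?case using 3 by (intro step orbit.base)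
    next
      case (step y)
      then show ?case using \<open>\<And>y. _ \<Longrightarrow> _ \<Longrightarrow> sibling_perm R y \<in> _ \<and> _\<close>[of y] orbit.step[of y "sibling_perm ?F" v] by blast
    qed
    then show ?thesis using 3 Nd by (simp del: sibling_perm.simps)
  qed
qed auto

text \<open>The counterpart of \<open>leader_of F v = v\<close> without a plane forest, in the form
  in which \<open>improper\<close> describes the rightmost child.\<close>

definition leader :: "(nat \<Rightarrow> nat) \<Rightarrow> (nat \<Rightarrow> nat) \<Rightarrow> nat set \<Rightarrow> nat \<Rightarrow> bool" where
  "leader p \<sigma> S v \<longleftrightarrow> (\<forall>c\<in>orbit \<sigma> v. Min (descendants p S v) \<le> Min (descendants p S c))"

lemma finite_subtree: "finite (subtree F v)"
  using finite_subset[OF subtree_subset] by simp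

lemma orbit_leader_of:
  assumes "distinct_labels F" "v \<in> labels F" "c \<in> orbit (sibling_perm F) v"
  shows "c \<in> labels F \<and> leader_of F c = leader_of F v"
  using assms(3) by induction (use assms sibling_perm_in[OF assms(1)] leader_of_sibling_perm[OF assms(1)] in auto)

text \<open>All members of an orbit share the value of \<open>leader_of\<close>, and this value has
  the strictly smallest subtree minimum among them.\<close>

lemma leader_iff_leader_of:
  assumes "distinct_labels F" "u \<notin> labels F" "v \<in> labels F"
  shows "leader (parent_of u F) (sibling_perm F) (labels F) v \<longleftrightarrow> leader_of F v = v"
proof -
  have less: "Min (subtree F (leader_of F c)) < Min (subtree F c)" if "c \<in> labels F" "leader_of F c \<noteq> c" for c
  proof -
    have "min_less (subtree F (leader_of F c)) (subtree F c)" using min_less_subtree_leader_of[OF assms(1) that] .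
    then obtain d where d: "d \<in> subtree F (leader_of F c)" "\<forall>x\<in>subtree F c. d < x"
      by (auto simp: min_less_def)
    have "Min (subtree F c) \<in> subtree F c" using self_in_subtree[OF that(1)] finite_subtree by (intro Min_in) auto
    then show ?thesis using d Min_le[OF finite_subtree d(1)] by (meson order_le_less_trans)
  qed
  show ?thesis
  proof
    assume L: "leader (parent_of u F) (sibling_perm F) (labels F) v"
    have "Min (subtree F v) \<le> Min (subtree F (leader_of F v))"
      using L leader_of_in_orbit[OF assms(1,3)] leader_of_in assms descendants_parent_of by (auto simp: leader_def)
    then show "leader_of F v = v" using less[OF assms(3)] by (meson leD)
  next
    assume L: "leader_of F v = v"
    show "leader (parent_of u F) (sibling_perm F) (labels F) v"
      unfolding leader_def
    proof
      fix c assume "c \<in> orbit (sibling_perm F) v"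
      then have c: "c \<in> labels F" "leader_of F c = v" using orbit_leader_of assms L by auto
      then have "Min (subtree F v) \<le> Min (subtree F c)" using less[of c] by (cases "c = v") auto
      then show "Min (descendants (parent_of u F) (labels F) v) \<le> Min (descendants (parent_of u F) (labels F) c)"
        using c assms by (simp add: descendants_parent_of)
    qed
  qed
qed

section \<open>The weight as a monomial\<close>

definition vertex_wt :: "bool \<Rightarrow> nat set \<Rightarrow> nat \<Rightarrow> int poly poly poly" where
  "vertex_wt l D u = (if l then if \<exists>d\<in>D. d < u then varY else if u = 0 then varX else 1 else varT)"

lemma wt_prod:
  "distinct_labels F \<Longrightarrow> wt u F = (\<Prod>v\<in>labels F. vertex_wt (leader_of F v = v) (subtree F v) (parent_of u F v))"
proof (induction F arbitrary: u)
  case (Nd a C R)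
  let ?F = "Nd a C R"
  let ?f = "\<lambda>v. vertex_wt (leader_of ?F v = v) (subtree ?F v) (parent_of u ?F v)"
  have ra: "R \<noteq> Emp \<Longrightarrow> lead R \<noteq> a" using lead_in[of R] Nd.prems by auto
  have "?f a = edge_wt u (insert a (labels C)) (labels R)"
    using ra by (cases "R = Emp") (auto simp: vertex_wt_def edge_wt_def)
  moreover have "(\<Prod>v\<in>labels C. ?f v) = wt a C"
    unfolding Nd.IH(1)[OF conjunct1[OF Nd.prems[simplified]], of a]
    using Nd.prems by (intro prod.cong) auto
  moreover have "(\<Prod>v\<in>labels R. ?f v) = wt u R"
  proof -
    have "(\<Prod>v\<in>labels R. ?f v) = (\<Prod>v\<in>labels R. vertex_wt (leader_of R v = v) (subtree R v) (parent_of u R v))"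
      using Nd.prems by (intro prod.cong) auto
    then show ?thesis using Nd by simp
  qed
  moreover have "(\<Prod>v\<in>labels ?F. ?f v) = ?f a * ((\<Prod>v\<in>labels C. ?f v) * (\<Prod>v\<in>labels R. ?f v))"
    using Nd.prems by (simp only: labels.simps) (subst prod.insert; auto simp: prod.union_disjoint)
  ultimately show ?case by (simp only: wt.simps mult.assoc)
qed auto

definition num_imp :: "(nat \<Rightarrow> nat) \<Rightarrow> (nat \<Rightarrow> nat) \<Rightarrow> nat set \<Rightarrow> nat" where
  "num_imp p \<sigma> S = card {v \<in> S. leader p \<sigma> S v \<and> Min (descendants p S v) < p v}"

definition num_root :: "(nat \<Rightarrow> nat) \<Rightarrow> (nat \<Rightarrow> nat) \<Rightarrow> nat set \<Rightarrow> nat" where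
  "num_root p \<sigma> S = card {v \<in> S. leader p \<sigma> S v \<and> p v = 0}"

definition num_nonleader :: "(nat \<Rightarrow> nat) \<Rightarrow> (nat \<Rightarrow> nat) \<Rightarrow> nat set \<Rightarrow> nat" where
  "num_nonleader p \<sigma> S = card {v \<in> S. \<not> leader p \<sigma> S v}"

lemma prod_if_power:
  assumes "finite S"
  shows "(\<Prod>v\<in>S. if A v then c else 1 :: 'a :: comm_semiring_1) = c ^ card {v \<in> S. A v}"
  using assms by (simp add: prod.If_cases Int_def)

lemma wt_monom:
  assumes "distinct_labels F" "0 \<notin> labels F"
  defines "p \<equiv> parent_of 0 F" and "\<sigma> \<equiv> sibling_perm F" and "S \<equiv> labels F"
  shows "wt 0 F = monom (monom (monom 1 (num_root p \<sigma> S)) (num_nonleader p \<sigma> S)) (num_imp p \<sigma> S)"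
proof -
  let ?L = "leader p \<sigma> S" and ?B = "\<lambda>v. Min (descendants p S v)"
  \<comment> \<open>At most one of the three factors differs from \<open>1\<close>: a minimum below
    \<open>p v\<close> excludes \<open>p v = 0\<close>.\<close>
  have "wt 0 F = (\<Prod>v\<in>S. (if ?L v \<and> ?B v < p v then varY else 1) * (if ?L v \<and> p v = 0 then varX else 1)
      * (if \<not> ?L v then varT else 1))"
    unfolding wt_prod[OF assms(1)] S_def
  proof (rule prod.cong[OF refl])
    fix v assume v: "v \<in> labels F"
    have d: "descendants p S v = subtree F v" using descendants_parent_of[OF assms(1,2) v] by (simp add: p_def S_def)
    have "?L v \<longleftrightarrow> leader_of F v = v" using leader_iff_leader_of[OF assms(1,2) v] by (simp add: p_def S_def \<sigma>_def)
    moreover have "(\<exists>d\<in>subtree F v. d < p v) \<longleftrightarrow> ?B v < p v"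
      unfolding d using self_in_subtree[OF v] finite_subtree[of F v] by (subst Min_less_iff) auto
    ultimately show "vertex_wt (leader_of F v = v) (subtree F v) (parent_of 0 F v) =
      (if leader p \<sigma> (labels F) v \<and> Min (descendants p (labels F) v) < p v then varY else 1)
      * (if leader p \<sigma> (labels F) v \<and> p v = 0 then varX else 1) * (if \<not> leader p \<sigma> (labels F) v then varT else 1)"
      unfolding vertex_wt_def S_def p_def[symmetric] by auto
  qed
  also have "\<dots> = varY ^ num_imp p \<sigma> S * varX ^ num_root p \<sigma> S * varT ^ num_nonleader p \<sigma> S"
    unfolding prod.distrib num_imp_def num_root_def num_nonleader_def
    by (simp only: prod_if_power S_def finite_labels)
  also have "\<dots> = monom (monom (monom 1 (num_root p \<sigma> S)) (num_nonleader p \<sigma> S)) (num_imp p \<sigma> S)"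
  proof -
    have varY: "varY ^ k = monom 1 k" for k by (simp add: monom_altdef)
    have varT: "varT ^ k = [:monom 1 k:]" for k
      by (induction k) (simp_all add: monom_Suc flip: one_pCons)
    have varX: "varX ^ k = [:[:monom 1 k:]:]" for k
      by (induction k) (simp_all add: monom_Suc flip: one_pCons)
    show ?thesis unfolding varY varT varX by (simp add: smult_monom mult_monom)
  qed
  finally show ?thesis .
qed

lemma forest_poly_eq_sum_perm_forests:
  "forest_poly n = (\<Sum>(p, \<sigma>)\<in>perm_forests 0 {1..n}.
     monom (monom (monom 1 (num_root p \<sigma> {1..n})) (num_nonleader p \<sigma> {1..n})) (num_imp p \<sigma> {1..n}))"
proof -
  have "bij_betw (\<lambda>F. (parent_of 0 F, sibling_perm F)) (plane_forests {1..n}) (perm_forests 0 {1..n})"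
    by (rule bij_betw_plane_forests_perm_forests) auto
  then show ?thesis
    unfolding forest_poly_def by (subst sum.reindex_bij_betw[symmetric]) (auto simp: plane_forests_def wt_monom intro!: sum.cong)
qed

text \<open>The function \<open>leader_of\<close> carries over by surjectivity of the encoding; it
  will show that every black vertex has exactly one leader among its children.\<close>

lemma perm_forests_leader:
  assumes "finite S" "u \<notin> S" "(p, \<sigma>) \<in> perm_forests u S"
  shows "\<exists>l. \<forall>v\<in>S. (leader p \<sigma> S v \<longleftrightarrow> l v = v) \<and> l v \<in> orbit \<sigma> v \<and> (\<forall>c\<in>orbit \<sigma> v. l c = l v)"
proof -
  obtain F where F: "distinct_labels F" "labels F = S" "parent_of u F = p" "sibling_perm F = \<sigma>"
    using surj_parent_of_sibling_perm[OF assms] by blast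
  show ?thesis
    using F assms(2) leader_iff_leader_of[of F u] leader_of_in_orbit[of F] orbit_leader_of[of F]
    by (intro exI[of _ "leader_of F"]) auto
qed

section \<open>Half-mobile forests\<close>

text \<open>For a permutation of a finite set the exponent \<open>0\<close> adds nothing to an
  orbit, so reachability by powers is membership in \<open>orbit\<close>.\<close>

lemma is_cyclic_order_iff:
  assumes "finite B" "B \<noteq> {}"
  shows "is_cyclic_order B s \<longleftrightarrow> s permutes B \<and> cyclic_on s B"
proof (cases "s permutes B")
  case True
  have "permutation s" using True assms(1) by (auto simp: permutation_permutes)
  then have mem: "v \<in> orbit s u \<longleftrightarrow> (\<exists>k. (s ^^ k) u = v)" for u v
    by (subst orbit_altdef_permutation) auto
  have "orbit s u \<subseteq> B" if "u \<in> B" for u using True that by (rule permutes_orbit_subset)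
  then have "B = orbit s u \<longleftrightarrow> (\<forall>v\<in>B. \<exists>k. (s ^^ k) u = v)" if "u \<in> B" for u
    using that unfolding mem[symmetric] by blast
  then show ?thesis using True assms(2) unfolding is_cyclic_order_def cyclic_on_alldef by simp
qed (simp add: is_cyclic_order_def)

section \<open>Translation between half-mobile forests and permuted forests\<close>

definition white_parent :: "(vtx \<Rightarrow> vtx option) \<Rightarrow> nat \<Rightarrow> nat" where
  "white_parent par v = (case par (W v) of None \<Rightarrow> 0 | Some (W u) \<Rightarrow> u
     | Some (Bk B) \<Rightarrow> (case par (Bk B) of Some (W u) \<Rightarrow> u | _ \<Rightarrow> 0))"

definition white_perm :: "(vtx \<Rightarrow> vtx option) \<Rightarrow> (nat set \<Rightarrow> nat \<Rightarrow> nat) \<Rightarrow> nat \<Rightarrow> nat" where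
  "white_perm par cyc v = (case par (W v) of Some (Bk B) \<Rightarrow> cyc B v | _ \<Rightarrow> v)"

text \<open>Labels start at \<open>1\<close>, so \<open>0\<close> is free to encode a missing white
  ancestor.\<close>

definition white_opt :: "nat \<Rightarrow> vtx option" where
  "white_opt u = (if u = 0 then None else Some (W u))"

definition nontriv_orbits :: "(nat \<Rightarrow> nat) \<Rightarrow> nat set set" where
  "nontriv_orbits \<sigma> = {orbit \<sigma> v | v. \<sigma> v \<noteq> v}"

text \<open>\<open>Min B\<close> merely selects a representative: for a pair in
  \<open>perm_forests\<close>, \<open>p\<close> is constant on the orbits of
  \<open>\<sigma>\<close>.\<close>

definition vtx_parent :: "(nat \<Rightarrow> nat) \<Rightarrow> (nat \<Rightarrow> nat) \<Rightarrow> vtx \<Rightarrow> vtx option" where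
  "vtx_parent p \<sigma> x = (case x of W v \<Rightarrow> if \<sigma> v \<noteq> v then Some (Bk (orbit \<sigma> v)) else white_opt (p v)
     | Bk B \<Rightarrow> if B \<in> nontriv_orbits \<sigma> then white_opt (p (Min B)) else None)"

text \<open>\<open>perm_restrict\<close> fixes everything outside \<open>B\<close>, as
  \<open>is_cyclic_order\<close> demands.\<close>

definition vtx_cyc :: "(nat \<Rightarrow> nat) \<Rightarrow> nat set \<Rightarrow> nat \<Rightarrow> nat" where
  "vtx_cyc \<sigma> B = (if B \<in> nontriv_orbits \<sigma> then perm_restrict \<sigma> B else id)"

text \<open>\<open>is_hforest\<close> without acyclicity. For a forest built from a pair
  \<open>(p, \<sigma>)\<close>, acyclicity follows only afterwards from \<open>acyclic_iff\<close>,
  which is proved in this locale.\<close>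

locale half_mobile =
  fixes n :: nat and par :: "vtx \<Rightarrow> vtx option" and cyc :: "nat set \<Rightarrow> nat \<Rightarrow> nat"
  assumes par_outside: "x \<notin> verts n par \<Longrightarrow> par x = None"
    and par_W_W: "par (W v) = Some (W u) \<Longrightarrow> u \<in> {1..n}"
    and par_W_Bk: "par (W v) = Some (Bk B) \<Longrightarrow> v \<in> B"
    and black_subset: "B \<in> blacks par \<Longrightarrow> B \<subseteq> {1..n}"
    and black_card: "B \<in> blacks par \<Longrightarrow> 2 \<le> card B"
    and black_child: "B \<in> blacks par \<Longrightarrow> v \<in> B \<Longrightarrow> par (W v) = Some (Bk B)"
    and par_Bk: "B \<in> blacks par \<Longrightarrow> par (Bk B) = Some x \<Longrightarrow> \<exists>u\<in>{1..n}. x = W u"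
    and cyc_black: "B \<in> blacks par \<Longrightarrow> is_cyclic_order B (cyc B)"
    and cyc_nonblack: "B \<notin> blacks par \<Longrightarrow> cyc B = id"

lemma W_in_verts [simp]: "W v \<in> verts n par \<longleftrightarrow> v \<in> {1..n}"
  by (auto simp: verts_def)

lemma Bk_in_verts [simp]: "Bk B \<in> verts n par \<longleftrightarrow> B \<in> blacks par"
  by (auto simp: verts_def)

lemma is_hforest_iff: "is_hforest n (par, cyc) \<longleftrightarrow> half_mobile n par cyc \<and> acyclic (par_rel par)"
proof
  assume "is_hforest n (par, cyc)"
  then have out: "\<forall>a. a \<notin> verts n par \<longrightarrow> par a = None"
    and W: "\<forall>v\<in>{1..n}. case par (W v) of None \<Rightarrow> True | Some (W u) \<Rightarrow> u \<in> {1..n} | Some (Bk B) \<Rightarrow> v \<in> B"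
    and B: "\<forall>B\<in>blacks par. B \<subseteq> {1..n} \<and> 2 \<le> card B \<and> (\<forall>v\<in>B. par (W v) = Some (Bk B))
         \<and> (case par (Bk B) of None \<Rightarrow> True | Some (W u) \<Rightarrow> u \<in> {1..n} | Some (Bk _) \<Rightarrow> False)"
    and ac: "acyclic (par_rel par)"
    and cyc: "\<forall>B\<in>blacks par. is_cyclic_order B (cyc B)" "\<forall>B. B \<notin> blacks par \<longrightarrow> cyc B = id"
    by (simp_all add: is_hforest_def Let_def)
  have W': "v \<in> {1..n}" if "par (W v) = Some x" for v x
    using that out[rule_format, of "W v"] by (cases "v \<in> {1..n}") auto
  have "half_mobile n par cyc"
  proof
    fix v u assume "par (W v) = Some (W u)"
    then show "u \<in> {1..n}" using W' W by fastforce
  next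
    fix v B assume "par (W v) = Some (Bk B)"
    then show "v \<in> B" using W' W by fastforce
  next
    fix B x assume "B \<in> blacks par" "par (Bk B) = Some x"
    then show "\<exists>u\<in>{1..n}. x = W u" using B by (cases x) fastforce+
  qed (use out B cyc in auto)
  then show "half_mobile n par cyc \<and> acyclic (par_rel par)" using ac by simp
next
  assume A: "half_mobile n par cyc \<and> acyclic (par_rel par)"
  then interpret half_mobile n par cyc by simp
  have "case par (W v) of None \<Rightarrow> True | Some (W u) \<Rightarrow> u \<in> {1..n} | Some (Bk B) \<Rightarrow> v \<in> B" for v
    using par_W_W[of v] par_W_Bk[of v] by (auto split: option.split vtx.split)
  moreover have "case par (Bk B) of None \<Rightarrow> True | Some (W u) \<Rightarrow> u \<in> {1..n} | Some (Bk _) \<Rightarrow> False"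
    if "B \<in> blacks par" for B
    using par_Bk[OF that] by (auto split: option.split vtx.split)
  ultimately show "is_hforest n (par, cyc)"
    using A par_outside black_subset black_card black_child cyc_black cyc_nonblack
    unfolding is_hforest_def by (auto simp: Let_def)
qed

text \<open>A walk in a functional graph that starts on a cycle stays on it. This will exclude
  cycles, because \<open>0\<close> is reachable from every label but has no outgoing edge.\<close>

lemma trancl_self_forward:
  assumes "single_valued r" "(x, x) \<in> r\<^sup>+" "(x, y) \<in> r\<^sup>*"
  shows "(y, y) \<in> r\<^sup>+"
  using assms(3)
proof (induction rule: rtrancl_induct)
  case (step y z)
  obtain z' where "(y, z') \<in> r" "(z', y) \<in> r\<^sup>*" using step.IH by (auto dest: tranclD)
  moreover have "z' = z" using \<open>(y, z') \<in> r\<close> step.hyps(2) assms(1) by (auto dest: single_valuedD)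
  ultimately show ?case using step.hyps(2) by (auto intro: rtrancl_into_trancl1)
qed (rule assms(2))

context half_mobile
begin

abbreviation "p \<equiv> white_parent par"
abbreviation "\<sigma> \<equiv> white_perm par cyc"
abbreviation "S \<equiv> {1..n}"
abbreviation "E \<equiv> edges p S"
abbreviation "L \<equiv> leader p \<sigma> S"

lemma par_W_in: "par (W v) = Some x \<Longrightarrow> v \<in> S"
  using par_outside[of "W v"] by (cases "v \<in> S") auto

lemma blackI: "par (W v) = Some (Bk B) \<Longrightarrow> B \<in> blacks par"
  by (auto simp: blacks_def)

lemma par_Bk_black: "par (Bk B) = Some x \<Longrightarrow> B \<in> blacks par"
  using par_outside[of "Bk B"] by (cases "B \<in> blacks par") auto

lemma par_Bk_W: "par (Bk B) = Some x \<Longrightarrow> \<exists>u\<in>S. x = W u"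
  using par_Bk par_Bk_black by blast

lemma black_unique: "B \<in> blacks par \<Longrightarrow> B' \<in> blacks par \<Longrightarrow> v \<in> B \<Longrightarrow> v \<in> B' \<Longrightarrow> B = B'"
  using black_child[of B v] black_child[of B' v] by simp

lemma finite_black: "B \<in> blacks par \<Longrightarrow> finite B"
  using black_card card.infinite by fastforce

lemma cyc_permutes: "B \<in> blacks par \<Longrightarrow> cyc B permutes B"
  using cyc_black by (auto simp: is_cyclic_order_def)

lemma white_perm_black: "B \<in> blacks par \<Longrightarrow> v \<in> B \<Longrightarrow> \<sigma> v = cyc B v"
  using black_child by (simp add: white_perm_def)

lemma white_perm_black_in: "B \<in> blacks par \<Longrightarrow> v \<in> B \<Longrightarrow> \<sigma> v \<in> B"
  using cyc_permutes by (simp add: white_perm_black permutes_in_image)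

lemma white_perm_nonblack: "(\<And>B. par (W v) \<noteq> Some (Bk B)) \<Longrightarrow> \<sigma> v = v"
  by (auto simp: white_perm_def split: option.split vtx.split)

text \<open>On \<open>B\<close> the permutation agrees with \<open>cyc B\<close>, which is a single
  cycle.\<close>

lemma orbit_black:
  assumes "B \<in> blacks par" "v \<in> B"
  shows "orbit \<sigma> v = B"
proof -
  have "orbit \<sigma> v = orbit (cyc B) v"
    using assms white_perm_black white_perm_black_in by (intro orbit_cong0[of v B]) auto
  also have "\<dots> = B"
    using cyc_black[OF assms(1)] is_cyclic_order_iff[OF finite_black[OF assms(1)]] assms(2)
    by (intro orbit_cyclic_eq3) auto
  finally show ?thesis .
qed

lemma white_perm_black_neq: "B \<in> blacks par \<Longrightarrow> v \<in> B \<Longrightarrow> \<sigma> v \<noteq> v"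
  using orbit_black[of B v] orbit_eq_singleton_iff[of \<sigma> v] black_card[of B] by auto

text \<open>Numbers outside \<open>S\<close> fall under the first case, because
  \<open>par_outside\<close> makes them parentless.\<close>

lemma vertex_cases:
  obtains "par (W v) = None" "p v = 0" "\<sigma> v = v"
  | u where "u \<in> S" "v \<in> S" "par (W v) = Some (W u)" "p v = u" "\<sigma> v = v"
  | B where "B \<in> blacks par" "v \<in> B" "v \<in> S" "par (W v) = Some (Bk B)" "par (Bk B) = white_opt (p v)"
      "p v \<in> insert 0 S" "\<sigma> v = cyc B v"
proof (cases "par (W v)")
  case None
  then show ?thesis using that(1) by (simp add: white_parent_def white_perm_def)
next
  case (Some x)
  then have v: "v \<in> S" by (rule par_W_in)
  show ?thesis
  proof (cases x)
    case (W u)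
    then show ?thesis using that(2)[of u] v Some par_W_W by (simp add: white_parent_def white_perm_def)
  next
    case (Bk B)
    then have B: "B \<in> blacks par" "v \<in> B" using Some blackI par_W_Bk by auto
    show ?thesis
    proof (cases "par (Bk B)")
      case None
      then show ?thesis using that(3)[of B] v B Some Bk by (simp add: white_parent_def white_perm_def white_opt_def)
    next
      case (Some y)
      then obtain u where "u \<in> S" "y = W u" using par_Bk_W by blast
      then show ?thesis using that(3)[of B] v B Some \<open>par (W v) = Some x\<close> Bk
        by (simp add: white_parent_def white_perm_def white_opt_def)
    qed
  qed
qed

lemma white_parent_outside: "v \<notin> S \<Longrightarrow> p v = 0"
  by (cases v rule: vertex_cases) auto

lemma white_parent_range: "p v \<in> insert 0 S"
  by (cases v rule: vertex_cases) auto

lemma white_perm_permutes: "\<sigma> permutes S"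
proof (rule permutes_finiteI)
  show "inj_on \<sigma> S"
  proof (rule inj_onI)
    fix v w assume eq: "\<sigma> v = \<sigma> w"
    \<comment> \<open>If \<open>\<sigma> w\<close> lies in \<open>B\<close>, so does
      \<open>w\<close>: either \<open>w\<close> belongs to a black set, which contains
      \<open>\<sigma> w\<close> and hence equals \<open>B\<close>, or
      \<open>\<sigma> w = w\<close>.\<close>
    have *: "v = w" if "par (W v) = Some (Bk B)" "\<sigma> v = \<sigma> w" for v w B
    proof -
      have B: "B \<in> blacks par" "v \<in> B" using that blackI par_W_Bk by auto
      have "\<sigma> w \<in> B" using white_perm_black_in[OF B] that(2) by simp
      then have sw: "par (W (\<sigma> w)) = Some (Bk B)" using black_child[OF B(1)] by simp
      have "w \<in> B"
      proof (cases "\<exists>B'. par (W w) = Some (Bk B')")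
        case True
        then obtain B' where B': "B' \<in> blacks par" "w \<in> B'" using blackI par_W_Bk by blast
        have "par (W (\<sigma> w)) = Some (Bk B')" using black_child[OF B'(1)] white_perm_black_in[OF B'] by simp
        then show ?thesis using sw B' by simp
      next
        case False
        then show ?thesis using white_perm_nonblack[of w] \<open>\<sigma> w \<in> B\<close> by auto
      qed
      then have "cyc B v = cyc B w" using that(2) white_perm_black B by simp
      then show ?thesis using cyc_permutes[OF B(1)] by (meson injD permutes_inj)
    qed
    show "v = w"
    proof (cases "\<exists>B. par (W v) = Some (Bk B) \<or> par (W w) = Some (Bk B)")
      case True
      then show ?thesis using *[of v _ w] *[of w _ v] eq by auto
    next
      case False
      then show ?thesis using eq white_perm_nonblack[of v] white_perm_nonblack[of w] by auto
    qed
  qed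
  show "\<sigma> ` S \<subseteq> S"
  proof
    fix w assume "w \<in> \<sigma> ` S"
    then obtain v where v: "v \<in> S" "w = \<sigma> v" by auto
    show "w \<in> S"
    proof (cases v rule: vertex_cases)
      case (3 B)
      then show ?thesis using v(2) white_perm_black_in[of B v] black_subset[of B] by blast
    qed (use v in auto)
  qed
  fix v assume "v \<notin> S"
  then show "\<sigma> v = v" by (cases v rule: vertex_cases) auto
qed simp

lemma white_parent_black:
  assumes "B \<in> blacks par" "v \<in> B"
  shows "par (Bk B) = white_opt (p v)"
  using assms black_child[OF assms] by (cases v rule: vertex_cases) auto

lemma white_opt_inj: "white_opt a = white_opt b \<Longrightarrow> a = b"
  by (auto simp: white_opt_def split: if_splits)

lemma white_parent_white_perm: "p (\<sigma> v) = p v"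
proof (cases v rule: vertex_cases)
  case (3 B)
  then have "par (Bk B) = white_opt (p (\<sigma> v))" using white_parent_black white_perm_black_in by blast
  then show ?thesis using 3 white_opt_inj by metis
qed simp_all

section \<open>Paths through black vertices\<close>

lemma edge_par_rel:
  assumes "v \<in> S" "p v \<noteq> 0"
  shows "(W v, W (p v)) \<in> (par_rel par)\<^sup>+"
proof (cases v rule: vertex_cases)
  case (3 B)
  then have "(W v, Bk B) \<in> par_rel par" "(Bk B, W (p v)) \<in> par_rel par"
    using assms by (auto simp: par_rel_def white_opt_def)
  then show ?thesis by auto
qed (use assms in \<open>auto simp: par_rel_def\<close>)

text \<open>An edge of \<open>p\<close> is one step of \<open>par_rel\<close>, or two through a
  black vertex, unless it ends in \<open>0\<close>. A path with another target never meets
  \<open>0\<close>, which has no outgoing edge.\<close>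

lemma edges_par_rel:
  assumes "(u, v) \<in> E\<^sup>*" "v \<noteq> 0"
  shows "(W u, W v) \<in> (par_rel par)\<^sup>*"
  using assms(1)
proof (induction rule: converse_rtrancl_induct)
  case (step y z)
  have "z \<noteq> 0"
    using step.hyps(2) assms(2) by (cases rule: converse_rtranclE) auto
  then have "(W y, W z) \<in> (par_rel par)\<^sup>+" using step.hyps(1) edge_par_rel[of y] by auto
  then show ?case using step.IH by (auto dest: trancl_into_rtrancl)
qed simp

lemma edges_trancl_par_rel:
  assumes "(u, v) \<in> E\<^sup>+" "v \<noteq> 0"
  shows "(W u, W v) \<in> (par_rel par)\<^sup>+"
proof -
  obtain y where y: "(u, y) \<in> E" "(y, v) \<in> E\<^sup>*" using assms(1) by (auto dest: tranclD)
  have "y \<noteq> 0" using y(2) assms(2) by (cases rule: converse_rtranclE) auto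
  then show ?thesis
    using y edge_par_rel[of u] edges_par_rel[OF y(2) assms(2)] by (auto dest: trancl_rtrancl_trancl)
qed

lemma par_rel_W: "(W u, W a) \<in> par_rel par \<Longrightarrow> (u, a) \<in> E"
  using par_W_in by (cases u rule: vertex_cases) (auto simp: par_rel_def)

lemma par_rel_Bk: "(Bk B, y) \<in> par_rel par \<Longrightarrow> \<exists>a\<in>S. y = W a \<and> (\<forall>b\<in>B. (b, a) \<in> E)"
proof -
  assume "(Bk B, y) \<in> par_rel par"
  then have y: "par (Bk B) = Some y" by (simp add: par_rel_def)
  then obtain a where a: "a \<in> S" "y = W a" using par_Bk_W by blast
  have B: "B \<in> blacks par" using par_Bk_black[OF y] .
  have "p b = a" if "b \<in> B" for b
    using white_parent_black[OF B that] y a by (auto simp: white_opt_def split: if_splits)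
  then show ?thesis using a black_subset[OF B] by auto
qed

text \<open>Black starting points are included, with a claim about all their children, so that the
  induction can pass through black vertices.\<close>

lemma par_rel_edges:
  assumes "(x, W v) \<in> (par_rel par)\<^sup>*"
  shows "case x of W u \<Rightarrow> (u, v) \<in> E\<^sup>* | Bk B \<Rightarrow> \<forall>b\<in>B. (b, v) \<in> E\<^sup>*"
  using assms
proof (induction rule: converse_rtrancl_induct)
  case (step x y)
  show ?case
  proof (cases x)
    case (W u)
    show ?thesis
    proof (cases y)
      case (W a)
      then have "(u, a) \<in> E" "(a, v) \<in> E\<^sup>*" using step \<open>x = W u\<close> par_rel_W[of u a] by simp_all
      then show ?thesis using \<open>x = W u\<close> by (simp add: converse_rtrancl_into_rtrancl)
    next
      case (Bk B)
      then show ?thesis using step W par_W_Bk[of u B] by (auto simp: par_rel_def)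
    qed
  next
    case (Bk B)
    then obtain a where a: "y = W a" "\<forall>b\<in>B. (b, a) \<in> E" using step par_rel_Bk[of B y] by blast
    then have "(a, v) \<in> E\<^sup>*" using step by simp
    then have "\<forall>b\<in>B. (b, v) \<in> E\<^sup>*" using a(2) by (meson converse_rtrancl_into_rtrancl)
    then show ?thesis using Bk by simp
  qed
qed simp

lemma par_rel_cycle:
  assumes "(W v, W v) \<in> (par_rel par)\<^sup>+"
  shows "(v, v) \<in> E\<^sup>+"
proof -
  obtain y where y: "(W v, y) \<in> par_rel par" "(y, W v) \<in> (par_rel par)\<^sup>*"
    using assms by (auto dest: tranclD)
  show ?thesis
  proof (cases y)
    case (W a)
    then have "(v, a) \<in> E" "(a, v) \<in> E\<^sup>*" using y par_rel_W[of v a] par_rel_edges[OF y(2)] by simp_all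
    then show ?thesis by (rule rtrancl_into_trancl2)
  next
    case (Bk B)
    have "v \<in> B" using y(1) Bk par_W_Bk by (simp add: par_rel_def)
    obtain z where z: "(Bk B, z) \<in> par_rel par" "(z, W v) \<in> (par_rel par)\<^sup>*"
      using y(2) Bk by (auto elim: converse_rtranclE)
    then obtain a where a: "z = W a" "(v, a) \<in> E" using par_rel_Bk \<open>v \<in> B\<close> by blast
    then have "(a, v) \<in> E\<^sup>*" using par_rel_edges[OF z(2)] by simp
    with a(2) show ?thesis by (rule rtrancl_into_trancl2)
  qed
qed

lemma acyclic_iff: "acyclic (par_rel par) \<longleftrightarrow> (\<forall>v\<in>S. (v, 0) \<in> E\<^sup>+)"
proof
  assume ac: "acyclic (par_rel par)"
  have "acyclic E"
  proof (rule acyclicI, intro allI notI)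
    fix v assume v: "(v, v) \<in> E\<^sup>+"
    then have "v \<in> S" by (auto dest: tranclD)
    then show False using edges_trancl_par_rel[OF v] ac by (auto simp: acyclic_def)
  qed
  moreover have "finite E" by (simp add: edges_def)
  \<comment> \<open>Well-foundedness of the converse allows induction from a parent to its
    children.\<close>
  ultimately have wf: "wf (E\<inverse>)" by (rule finite_acyclic_wf_converse[rotated])
  have "v \<in> S \<longrightarrow> (v, 0) \<in> E\<^sup>+" for v
    using wf
  proof (induction v rule: wf_induct_rule)
    case (less v)
    show ?case
    proof
      assume v: "v \<in> S"
      show "(v, 0) \<in> E\<^sup>+"
      proof (cases "p v = 0")
        case False
        then have "(p v, 0) \<in> E\<^sup>+" using less[of "p v"] v white_parent_range[of v] by auto
        then show ?thesis using v by (auto intro: trancl_into_trancl2)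
      qed (use v in auto)
    qed
  qed
  then show "\<forall>v\<in>S. (v, 0) \<in> E\<^sup>+" by blast
next
  assume reach: "\<forall>v\<in>S. (v, 0) \<in> E\<^sup>+"
  show "acyclic (par_rel par)"
  proof (rule acyclicI, intro allI notI)
    fix x assume x: "(x, x) \<in> (par_rel par)\<^sup>+"
    \<comment> \<open>Every cycle contains a white vertex, since the parent of a black vertex is
      white.\<close>
    obtain v where "(W v, W v) \<in> (par_rel par)\<^sup>+"
    proof (cases x)
      case (Bk B)
      obtain y where y: "(x, y) \<in> par_rel par" "(y, x) \<in> (par_rel par)\<^sup>*"
        using x by (auto dest: tranclD)
      then obtain a where "y = W a" using par_rel_Bk Bk by blast
      then show ?thesis using y that[of a] by (auto intro: rtrancl_into_trancl1)
    qed (use x that in auto)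
    then have v: "(v, v) \<in> E\<^sup>+" by (rule par_rel_cycle)
    then have "v \<in> S" by (auto dest: tranclD)
    then have "(v, 0) \<in> E\<^sup>*" using reach by (auto dest: trancl_into_rtrancl)
    then have "(0, 0) \<in> E\<^sup>+" by (rule trancl_self_forward[OF single_valued_edges v])
    then show False by (auto dest: tranclD)
  qed
qed

lemma white_parent_white_perm_perm_forests: "acyclic (par_rel par) \<Longrightarrow> (p, \<sigma>) \<in> perm_forests 0 S"
  unfolding perm_forests_def using white_perm_permutes white_parent_outside white_parent_range white_parent_white_perm acyclic_iff by auto

lemma beta_W: "v \<in> S \<Longrightarrow> beta par (W v) = Min (descendants p S v)"
proof -
  assume "v \<in> S"
  then have "{u. (W u, W v) \<in> (par_rel par)\<^sup>*} = descendants p S v"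
    unfolding descendants_def using edges_par_rel[of _ v] par_rel_edges[of "W _" v] by auto
  then show ?thesis by (simp add: beta_def)
qed

lemma nontriv_orbits_white_perm: "nontriv_orbits \<sigma> = blacks par"
proof (intro equalityI subsetI)
  fix B assume "B \<in> nontriv_orbits \<sigma>"
  then obtain v where v: "\<sigma> v \<noteq> v" "B = orbit \<sigma> v" by (auto simp: nontriv_orbits_def)
  then show "B \<in> blacks par" using orbit_black by (cases v rule: vertex_cases) auto
next
  fix B assume B: "B \<in> blacks par"
  then obtain v where "v \<in> B" using par_W_Bk by (auto simp: blacks_def)
  then show "B \<in> nontriv_orbits \<sigma>" using orbit_black[OF B] white_perm_black_neq[OF B] by (auto simp: nontriv_orbits_def)
qed

lemma black_nonempty: "B \<in> blacks par \<Longrightarrow> B \<noteq> {}"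
  using black_card by fastforce

lemma vtx_parent_white_parent: "vtx_parent p \<sigma> = par"
proof
  fix x show "vtx_parent p \<sigma> x = par x"
  proof (cases x)
    case (W v)
    show ?thesis
    proof (cases v rule: vertex_cases)
      case (3 B)
      then show ?thesis using W orbit_black[of B v] white_perm_black_neq[of B v] by (simp add: vtx_parent_def)
    qed (use W in \<open>auto simp: vtx_parent_def white_opt_def\<close>)
  next
    case (Bk B)
    show ?thesis
    proof (cases "B \<in> blacks par")
      case True
      then have "Min B \<in> B" using finite_black black_nonempty by (intro Min_in) auto
      then show ?thesis using True Bk white_parent_black[of B "Min B"] by (simp add: vtx_parent_def nontriv_orbits_white_perm)
    next
      case False
      then have "par (Bk B) = None" using par_Bk_black by (cases "par (Bk B)") auto
      then show ?thesis using False Bk by (simp add: vtx_parent_def nontriv_orbits_white_perm)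
    qed
  qed
qed

lemma vtx_cyc_white_perm: "vtx_cyc \<sigma> = cyc"
proof
  fix B show "vtx_cyc \<sigma> B = cyc B"
  proof (cases "B \<in> blacks par")
    case True
    then show ?thesis using white_perm_black[OF True] cyc_permutes[OF True]
      by (auto simp: vtx_cyc_def nontriv_orbits_white_perm perm_restrict_def permutes_not_in fun_eq_iff)
  qed (simp add: vtx_cyc_def nontriv_orbits_white_perm cyc_nonblack)
qed

section \<open>Comparison of the statistics\<close>

lemma improper_iff:
  assumes "b \<in> S"
  shows "improper par b \<longleftrightarrow> L b \<and> Min (descendants p S b) < p b"
proof (cases b rule: vertex_cases)
  case 1
  then show ?thesis by (simp add: improper_def)
next
  case (2 u)
  \<comment> \<open>A child of a white vertex is a fixed point of \<open>\<sigma>\<close> and thus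
    trivially a leader.\<close>
  then have "orbit \<sigma> b = {b}" by (simp add: orbit_eq_singleton_iff)
  then show ?thesis using 2 by (simp add: improper_def leader_def beta_W)
next
  case (3 B)
  have "L b \<longleftrightarrow> (\<forall>c\<in>B. beta par (W b) \<le> beta par (W c))"
    unfolding leader_def orbit_black[OF 3(1,2)]
  proof (rule ball_cong[OF refl])
    fix c assume "c \<in> B"
    then have "c \<in> S" using black_subset[OF 3(1)] by blast
    then show "Min (descendants p S b) \<le> Min (descendants p S c) \<longleftrightarrow> beta par (W b) \<le> beta par (W c)"
      by (simp only: beta_W assms)
  qed
  moreover have "(\<exists>a. par (Bk B) = Some (W a) \<and> a > beta par (W b)) \<longleftrightarrow> Min (descendants p S b) < p b"
    using 3 by (auto simp: white_opt_def beta_W)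
  ultimately show ?thesis using 3 by (simp add: improper_def)
qed

lemma imp_eq: "imp n (par, cyc) = num_imp p \<sigma> S"
  unfolding imp_def num_imp_def using improper_iff by (intro arg_cong[of _ _ card]) auto

text \<open>The unique leader is the rightmost child of \<open>B\<close> in its distinguished linear
  order.\<close>

lemma black_leader:
  assumes "acyclic (par_rel par)" "B \<in> blacks par"
  shows "\<exists>!v. v \<in> B \<and> L v"
proof -
  have "0 \<notin> S" by simp
  from perm_forests_leader[OF finite_atLeastAtMost this white_parent_white_perm_perm_forests[OF assms(1)]]
  obtain l where l: "\<forall>v\<in>S. (L v \<longleftrightarrow> l v = v) \<and> l v \<in> orbit \<sigma> v \<and> (\<forall>c\<in>orbit \<sigma> v. l c = l v)"
    by (rule exE)
  obtain v where v: "v \<in> B" using black_nonempty[OF assms(2)] by auto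
  have L: "L w \<longleftrightarrow> l w = w" if "w \<in> B" for w
    using l that black_subset[OF assms(2)] by blast
  have "l v \<in> orbit \<sigma> v" "\<forall>c\<in>orbit \<sigma> v. l c = l v"
    using l v black_subset[OF assms(2)] by blast+
  then have lv: "l v \<in> B" and lw: "\<And>w. w \<in> B \<Longrightarrow> l w = l v"
    unfolding orbit_black[OF assms(2) v] by auto
  show ?thesis
  proof (rule ex1I[of _ "l v"])
    show "l v \<in> B \<and> L (l v)" using lv lw[OF lv] L[OF lv] by simp
  next
    fix w assume "w \<in> B \<and> L w"
    then show "w = l v" using lw[of w] L[of w] by simp
  qed
qed

text \<open>Fixed points of \<open>\<sigma>\<close> are leaders, so every non-leader is a child of a
  black vertex, and each black vertex has exactly one child that is a leader.\<close>

lemma bdeg_eq: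
  assumes "acyclic (par_rel par)"
  shows "bdeg (par, cyc) = num_nonleader p \<sigma> S"
proof -
  have fin: "finite (blacks par)"
    using finite_subset[of "blacks par" "Pow S"] black_subset by auto
  have card: "card {v \<in> B. \<not> L v} = card B - 1" if B: "B \<in> blacks par" for B
  proof -
    obtain w where w: "w \<in> B \<and> L w" "\<forall>v. v \<in> B \<and> L v \<longrightarrow> v = w"
      using black_leader[OF assms B] by (rule ex1E)
    then have "{v \<in> B. \<not> L v} = B - {w}" "w \<in> B" by blast+
    then show ?thesis by simp
  qed
  have "{v \<in> S. \<not> L v} = (\<Union>B\<in>blacks par. {v \<in> B. \<not> L v})"
  proof (intro equalityI subsetI)
    fix v assume v: "v \<in> {v \<in> S. \<not> L v}"
    have "\<sigma> v \<noteq> v"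
    proof
      assume "\<sigma> v = v"
      then have "orbit \<sigma> v = {v}" by (simp add: orbit_eq_singleton_iff)
      then show False using v by (simp add: leader_def)
    qed
    then show "v \<in> (\<Union>B\<in>blacks par. {v \<in> B. \<not> L v})"
      using v by (cases v rule: vertex_cases) auto
  qed (use black_subset in blast)
  also have "card \<dots> = (\<Sum>B\<in>blacks par. card {v \<in> B. \<not> L v})"
  proof (rule card_UN_disjoint[OF fin])
    show "\<forall>B\<in>blacks par. finite {v \<in> B. \<not> L v}" using finite_black by auto
    show "\<forall>B\<in>blacks par. \<forall>B'\<in>blacks par. B \<noteq> B' \<longrightarrow> {v \<in> B. \<not> L v} \<inter> {v \<in> B'. \<not> L v} = {}"
      using black_unique by blast
  qed
  finally show ?thesis using card by (simp add: bdeg_def num_nonleader_def)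
qed

lemma tree_eq:
  assumes "acyclic (par_rel par)"
  shows "tree n (par, cyc) = num_root p \<sigma> S"
proof -
  \<comment> \<open>On leaders with \<open>p v = 0\<close>, \<open>f\<close> yields the root of the
    component: the vertex itself or the black root above it.\<close>
  define f where "f v = (case par (W v) of None \<Rightarrow> W v | Some q \<Rightarrow> q)" for v
  have leaf: "L v" if "\<sigma> v = v" for v
  proof -
    have "orbit \<sigma> v = {v}" using that by (simp add: orbit_eq_singleton_iff)
    then show ?thesis by (simp add: leader_def)
  qed
  have "bij_betw f {v \<in> S. L v \<and> p v = 0} {a \<in> verts n par. par a = None}"
    unfolding bij_betw_def
  proof (intro conjI equalityI subsetI)
    show "inj_on f {v \<in> S. L v \<and> p v = 0}"
    proof (rule inj_onI)
      fix v w assume v: "v \<in> {v \<in> S. L v \<and> p v = 0}" and w: "w \<in> {v \<in> S. L v \<and> p v = 0}"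
        and eq: "f v = f w"
      show "v = w"
      proof (cases v rule: vertex_cases)
        case 1
        then show ?thesis using eq w by (cases w rule: vertex_cases) (auto simp: f_def)
      next
        case (2 u)
        then show ?thesis using v by auto
      next
        case (3 B)
        then have "w \<in> B" using eq w by (cases w rule: vertex_cases) (auto simp: f_def)
        then show ?thesis using black_leader[OF assms 3(1)] 3 v w by auto
      qed
    qed
    fix a assume "a \<in> f ` {v \<in> S. L v \<and> p v = 0}"
    then obtain v where v: "v \<in> S" "p v = 0" "a = f v" by auto
    show "a \<in> {a \<in> verts n par. par a = None}"
      using v by (cases v rule: vertex_cases) (auto simp: f_def white_opt_def)
  next
    fix a assume a: "a \<in> {a \<in> verts n par. par a = None}"
    show "a \<in> f ` {v \<in> S. L v \<and> p v = 0}"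
    proof (cases a)
      case (W v)
      then have "v \<in> S" "par (W v) = None" using a by auto
      moreover have "p v = 0" "L v"
        using \<open>par (W v) = None\<close> leaf[of v] by (cases v rule: vertex_cases; simp)+
      ultimately show ?thesis using W by (auto simp: f_def image_iff intro!: bexI[of _ v])
    next
      case (Bk B)
      then have B: "B \<in> blacks par" using a by auto
      obtain v where v: "v \<in> B" "L v" using black_leader[OF assms B] by auto
      have "p v = 0" using white_parent_black[OF B v(1)] a Bk by (auto simp: white_opt_def split: if_splits)
      moreover have "f v = a" using black_child[OF B v(1)] Bk by (simp add: f_def)
      ultimately show ?thesis using v black_subset[OF B] by auto
    qed
  qed
  then show ?thesis using bij_betw_same_card by (fastforce simp: tree_def num_root_def)
qed

end

section \<open>From pairs back to half-mobile forests\<close>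

lemma half_mobile_vtx_parent:
  assumes "(p, \<sigma>) \<in> perm_forests 0 {1..n}"
  shows "half_mobile n (vtx_parent p \<sigma>) (vtx_cyc \<sigma>)" "white_parent (vtx_parent p \<sigma>) = p" "white_perm (vtx_parent p \<sigma>) (vtx_cyc \<sigma>) = \<sigma>"
    "acyclic (par_rel (vtx_parent p \<sigma>))"
proof -
  have perm: "\<sigma> permutes {1..n}" and p0: "\<And>v. v \<notin> {1..n} \<Longrightarrow> p v = 0"
    and pS: "\<And>v. v \<in> {1..n} \<Longrightarrow> p v \<in> insert 0 {1..n}"
    and reach: "\<And>v. v \<in> {1..n} \<Longrightarrow> (v, 0) \<in> (edges p {1..n})\<^sup>+"
    and p\<sigma>: "\<And>v. v \<in> {1..n} \<Longrightarrow> p (\<sigma> v) = p v"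
    using assms by (auto simp: perm_forests_def)
  have pn: "permutation \<sigma>" using perm by (auto simp: permutation_permutes)
  have self: "v \<in> orbit \<sigma> v" for v by (rule permutation_self_in_orbit[OF pn])
  have moved: "v \<in> {1..n}" if "\<sigma> v \<noteq> v" for v using that perm permutes_not_in by metis
  have subtree: "orbit \<sigma> v \<subseteq> {1..n}" if "\<sigma> v \<noteq> v" for v
    using permutes_orbit_subset[OF perm moved[OF that]] .
  have eq: "orbit \<sigma> w = orbit \<sigma> v" if "w \<in> orbit \<sigma> v" for v w
    using orbit_cyclic_eq3[OF cyclic_on_orbit'[OF pn] that] .
  have neq: "\<sigma> w \<noteq> w" if "w \<in> orbit \<sigma> v" "\<sigma> v \<noteq> v" for v w
  proof
    assume "\<sigma> w = w"
    then have "orbit \<sigma> w = {w}" by (simp add: orbit_eq_singleton_iff)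
    then show False using eq[OF that(1)] self[of v] that(2) \<open>\<sigma> w = w\<close> by auto
  qed
  \<comment> \<open>This makes the choice of \<open>Min B\<close> in \<open>vtx_parent\<close>
    immaterial.\<close>
  have p_orbit: "p w = p v" if "w \<in> orbit \<sigma> v" "\<sigma> v \<noteq> v" for v w
    using that(1)
  proof induction
    case base
    then show ?case using p\<sigma> moved that(2) by simp
  next
    case (step y)
    then show ?case using p\<sigma>[of y] subtree[OF that(2)] by auto
  qed
  have fin: "finite (orbit \<sigma> v)" for v by (rule finite_orbit[OF self])
  have Min: "p (Min (orbit \<sigma> v)) = p v" if "\<sigma> v \<noteq> v" for v
    using p_orbit[OF Min_in[OF fin orbit_nonempty] that] .
  have white_opt_W: "white_opt u \<noteq> Some (Bk B)" for u B by (simp add: white_opt_def)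
  have blacks: "blacks (vtx_parent p \<sigma>) = nontriv_orbits \<sigma>"
    using white_opt_W by (auto simp: blacks_def nontriv_orbits_def vtx_parent_def split: if_splits)
  have in_nontriv_orbits: "orbit \<sigma> v \<in> nontriv_orbits \<sigma>" if "\<sigma> v \<noteq> v" for v using that by (auto simp: nontriv_orbits_def)
  have white_opt_in: "u \<in> {1..n}" if "white_opt (p v) = Some (W u)" for u v
  proof -
    have "p v = u" "u \<noteq> 0" using that by (auto simp: white_opt_def split: if_splits)
    then show ?thesis using p0[of v] pS[of v] by (cases "v \<in> {1..n}") auto
  qed
  show half_mobile: "half_mobile n (vtx_parent p \<sigma>) (vtx_cyc \<sigma>)"
  proof
    fix x assume x: "x \<notin> verts n (vtx_parent p \<sigma>)"
    show "vtx_parent p \<sigma> x = None"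
    proof (cases x)
      case (W v)
      then have "v \<notin> {1..n}" using x by auto
      then show ?thesis using W p0 moved by (auto simp: vtx_parent_def white_opt_def)
    next
      case (Bk B)
      then show ?thesis using x by (auto simp: blacks vtx_parent_def)
    qed
  next
    fix v u assume "vtx_parent p \<sigma> (W v) = Some (W u)"
    then show "u \<in> {1..n}" using white_opt_in by (auto simp: vtx_parent_def split: if_splits)
  next
    fix v B assume "vtx_parent p \<sigma> (W v) = Some (Bk B)"
    then show "v \<in> B" using white_opt_W self by (auto simp: vtx_parent_def split: if_splits)
  next
    fix B assume "B \<in> blacks (vtx_parent p \<sigma>)"
    then obtain v where v: "B = orbit \<sigma> v" "\<sigma> v \<noteq> v" by (auto simp: blacks nontriv_orbits_def)
    show "B \<subseteq> {1..n}" using subtree v by simp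
    show "2 \<le> card B"
    proof -
      have "card {v, \<sigma> v} \<le> card B"
        using v fin self[of v] orbit.base[of \<sigma> v] by (intro card_mono) auto
      then show ?thesis using v by simp
    qed
    show "vtx_parent p \<sigma> (W w) = Some (Bk B)" if "w \<in> B" for w
      using that v eq[of w v] neq[of w v] by (simp add: vtx_parent_def)
    show "\<exists>u\<in>{1..n}. x = W u" if "vtx_parent p \<sigma> (Bk B) = Some x" for x
    proof -
      have "white_opt (p v) = Some x" using that v Min in_nontriv_orbits by (simp add: vtx_parent_def)
      moreover from this obtain u where "x = W u" by (auto simp: white_opt_def split: if_splits)
      ultimately show ?thesis using white_opt_in by blast
    qed
    have "perm_restrict \<sigma> B permutes B"
      using v fin permutes_inj[OF perm] orbit.step[of _ \<sigma> v]
      by (intro permutes_finiteI) (auto simp: perm_restrict_def inj_on_def inj_def)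
    moreover have "cyclic_on (perm_restrict \<sigma> B) B"
      using cyclic_on_orbit'[OF pn, of v] v cyclic_cong[of B "perm_restrict \<sigma> B" \<sigma>]
      by (simp add: perm_restrict_def)
    moreover have "finite B" "B \<noteq> {}" "vtx_cyc \<sigma> B = perm_restrict \<sigma> B"
      using v fin[of v] self[of v] in_nontriv_orbits[of v] by (auto simp: vtx_cyc_def)
    ultimately show "is_cyclic_order B (vtx_cyc \<sigma> B)" by (simp add: is_cyclic_order_iff)
  next
    fix B assume "B \<notin> blacks (vtx_parent p \<sigma>)"
    then show "vtx_cyc \<sigma> B = id" by (simp add: vtx_cyc_def blacks)
  qed
  show wp: "white_parent (vtx_parent p \<sigma>) = p"
  proof
    fix v show "white_parent (vtx_parent p \<sigma>) v = p v"
      using in_nontriv_orbits Min by (auto simp: white_parent_def vtx_parent_def white_opt_def)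
  qed
  show "white_perm (vtx_parent p \<sigma>) (vtx_cyc \<sigma>) = \<sigma>"
  proof
    fix v show "white_perm (vtx_parent p \<sigma>) (vtx_cyc \<sigma>) v = \<sigma> v"
      using in_nontriv_orbits self by (auto simp: white_perm_def vtx_parent_def white_opt_def vtx_cyc_def perm_restrict_def)
  qed
  show "acyclic (par_rel (vtx_parent p \<sigma>))"
    using half_mobile.acyclic_iff[OF half_mobile] reach wp by simp
qed

lemma bij_betw_H_perm_forests:
  "bij_betw (\<lambda>(par, cyc). (white_parent par, white_perm par cyc)) (H n) (perm_forests 0 {1..n})"
proof (rule bij_betw_byWitness[where f' = "\<lambda>(p, \<sigma>). (vtx_parent p \<sigma>, vtx_cyc \<sigma>)"])
  show "\<forall>F\<in>H n. (\<lambda>(p, \<sigma>). (vtx_parent p \<sigma>, vtx_cyc \<sigma>)) ((\<lambda>(par, cyc). (white_parent par, white_perm par cyc)) F) = F"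
    by (auto simp: H_def is_hforest_iff half_mobile.vtx_parent_white_parent half_mobile.vtx_cyc_white_perm simp del: One_nat_def)
  show "(\<lambda>(par, cyc). (white_parent par, white_perm par cyc)) ` H n \<subseteq> perm_forests 0 {1..n}"
    by (auto simp: H_def is_hforest_iff half_mobile.white_parent_white_perm_perm_forests simp del: One_nat_def)
  show "\<forall>x\<in>perm_forests 0 {1..n}. (\<lambda>(par, cyc). (white_parent par, white_perm par cyc)) ((\<lambda>(p, \<sigma>). (vtx_parent p \<sigma>, vtx_cyc \<sigma>)) x) = x"
    by (auto simp: half_mobile_vtx_parent simp del: One_nat_def)
  show "(\<lambda>(p, \<sigma>). (vtx_parent p \<sigma>, vtx_cyc \<sigma>)) ` perm_forests 0 {1..n} \<subseteq> H n"
    by (auto simp: H_def is_hforest_iff half_mobile_vtx_parent simp del: One_nat_def)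
qed

section \<open>The generating polynomial of half-mobile forests\<close>

lemma forest_poly_eq_sum_H:
  "forest_poly n = (\<Sum>F\<in>H n. monom (monom (monom 1 (tree n F)) (bdeg F)) (imp n F))"
proof -
  have "forest_poly n = (\<Sum>F\<in>H n. case (\<lambda>(par, cyc). (white_parent par, white_perm par cyc)) F of (p, \<sigma>) \<Rightarrow>
     monom (monom (monom 1 (num_root p \<sigma> {1..n})) (num_nonleader p \<sigma> {1..n})) (num_imp p \<sigma> {1..n}))"
    unfolding forest_poly_eq_sum_perm_forests by (rule sum.reindex_bij_betw[OF bij_betw_H_perm_forests, symmetric])
  also have "\<dots> = (\<Sum>F\<in>H n. monom (monom (monom 1 (tree n F)) (bdeg F)) (imp n F))"
    by (intro sum.cong refl) (auto simp: H_def is_hforest_iff half_mobile.tree_eq half_mobile.bdeg_eq half_mobile.imp_eq simp del: One_nat_def)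
  finally show ?thesis .
qed

lemma finite_H: "finite (H n)"
  using bij_betw_finite[OF bij_betw_H_perm_forests] bij_betw_finite[OF bij_betw_plane_forests_perm_forests[of "{1..n}" 0]]
    finite_plane_forests[of "{1..n}"] by simp

text \<open>Guarantees that \<open>tree n F - 1\<close> is not truncated. The path from
  \<open>1\<close> to \<open>0\<close> ends with a vertex \<open>v\<close> such that
  \<open>p v = 0\<close>; it is a root or the child of a black root.\<close>

lemma tree_pos:
  assumes "1 \<le> n" "F \<in> H n"
  shows "1 \<le> tree n F"
proof -
  obtain par cyc where F: "F = (par, cyc)" by fastforce
  interpret half_mobile n par cyc using assms F by (simp add: H_def is_hforest_iff)
  have ac: "acyclic (par_rel par)" using assms F by (simp add: H_def is_hforest_iff)
  have "(1, 0) \<in> E\<^sup>+" using acyclic_iff ac assms(1) by auto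
  then obtain v where v: "v \<in> S" "p v = 0" by (cases rule: tranclE) auto
  have "\<exists>a\<in>verts n par. par a = None"
  proof (cases v rule: vertex_cases)
    case 1
    then show ?thesis using v by (intro bexI[of _ "W v"]) auto
  next
    case (3 B)
    then show ?thesis using v by (intro bexI[of _ "Bk B"]) (auto simp: white_opt_def)
  qed (use v in auto)
  moreover have "finite (verts n par)"
    using finite_subset[of "blacks par" "Pow S"] black_subset by (auto simp: verts_def)
  ultimately have "card {a \<in> verts n par. par a = None} \<noteq> 0" by (auto simp: card_eq_0_iff)
  then show ?thesis by (simp add: tree_def F)
qed

theorem theorem3p3:
  fixes n k :: nat
  assumes "1 \<le> n" and "k \<le> n - 1"
  shows "Qnk n k = (\<Sum>F\<in>Hk n k. monom (monom 1 (tree n F - 1)) (bdeg F))"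
proof -
  let ?x = "[:[:0, 1:]:] :: int poly poly"
  \<comment> \<open>Both sides are compared after multiplication by \<open>?x\<close>, which is
    cancelled at the end in an integral domain.\<close>
  have "?x * Qnk n k = coeff (forest_poly n) k"
    unfolding varX_times_Qz1[OF assms(1), symmetric] by (simp add: Qnk_def)
  also have "\<dots> = (\<Sum>F\<in>H n. if imp n F = k then monom (monom 1 (tree n F)) (bdeg F) else 0)"
    by (simp add: forest_poly_eq_sum_H coeff_sum)
  also have "\<dots> = (\<Sum>F\<in>Hk n k. monom (monom 1 (tree n F)) (bdeg F))"
    unfolding Hk_def using finite_H by (simp add: sum.inter_filter)
  also have "\<dots> = (\<Sum>F\<in>Hk n k. ?x * monom (monom 1 (tree n F - 1)) (bdeg F))"
  proof (rule sum.cong[OF refl])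
    fix F assume "F \<in> Hk n k"
    then obtain m where "tree n F = Suc m"
      using tree_pos[OF assms(1), of F] by (cases "tree n F") (auto simp: Hk_def)
    then show "monom (monom 1 (tree n F)) (bdeg F) = ?x * monom (monom 1 (tree n F - 1)) (bdeg F)"
      by (simp add: monom_Suc smult_monom)
  qed
  finally have "?x * Qnk n k = ?x * (\<Sum>F\<in>Hk n k. monom (monom 1 (tree n F - 1)) (bdeg F))"
    by (simp only: sum_distrib_left)
  then show ?thesis by (subst (asm) mult_cancel_left) simp
qed

end
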